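(* Let $G$ be an infinite, vertex-transitive graph of finite degree. Let $\nu$ be a probability measure on $\mathbb{N}=\{0,1,2,\dots\}$ such that $\mu=\mu(\nu)<\infty$, where $\mu$ is twice the mean of $\nu$. Then the oil and water dynamics on $G$ started from the product initial configuration determined by $\nu$ fixates almost surely, i.e. \[ \mathbb{P}_\nu\bigl[\text{oil and water fixates}\bigr]=1 . \]
   Context: Oil and water model: there are two types of particles, oils and waters. Initially, at each vertex $x$ of $G$ one places a number of oils and, independently, a number of waters, each distributed according to $\nu$, independently over vertices; thus $\mu$ is the expected total number of particles at a vertex. Each vertex carries an independent rate-$1$ Poisson clock. When the clock of $x$ rings, if $x$ hosts at least one oil and at least one water, then $x$ fires: one oil and one water at $x$ each independently jump to a uniformly chosen neighbor of $x$ (one step of simple random walk); otherwise ($x$ has no particles or only particles of one type) nothing happens. $\mathbb{P}_\nu$ denotes the law of this dynamics. For $x\in V(G)$ and $t\ge0$ let $u_t(x)$ be the number of firings at $x$ up to time $t$. The process fixates if for every finite $A\subset V(G)$ there is a (random) finite time $\tau_A$ such that $u_t(x)=u_{\tau_A}(x)$ for all $x\in A$ and all $t>\tau_A$; otherwise it is active.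
   Formalization: The graph G is taken to be simple and connected; without connectedness the claim fails, e.g. for infinitely many disjoint edges, where one oil and one water on the same edge move together forever. *)

theory Defs
  imports "HOL-Probability.Probability"
begin

definition simple_graph :: "('v \<Rightarrow> 'v \<Rightarrow> bool) \<Rightarrow> bool" where
  "simple_graph E \<longleftrightarrow> (\<forall>x y. E x y \<longrightarrow> E y x) \<and> (\<forall>x. \<not> E x x)"

definition nbrs :: "('v \<Rightarrow> 'v \<Rightarrow> bool) \<Rightarrow> 'v \<Rightarrow> 'v set" where
  "nbrs E x = {y. E x y}"

definition connected_graph :: "('v \<Rightarrow> 'v \<Rightarrow> bool) \<Rightarrow> bool" where
  "connected_graph E \<longleftrightarrow> (\<forall>x y. E\<^sup>*\<^sup>* x y)"

definition finite_degree :: "('v \<Rightarrow> 'v \<Rightarrow> bool) \<Rightarrow> bool" where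
  "finite_degree E \<longleftrightarrow> (\<forall>x. finite (nbrs E x))"

definition vertex_transitive :: "('v \<Rightarrow> 'v \<Rightarrow> bool) \<Rightarrow> bool" where
  "vertex_transitive E \<longleftrightarrow>
     (\<forall>x y. \<exists>f. bij f \<and> (\<forall>a b. E a b \<longleftrightarrow> E (f a) (f b)) \<and> f x = y)"

text \<open>A sample point is a triple (eta0, S, ch):
  eta0 x = (number of oils, number of waters) initially at x;
  S (x,k) = k-th interarrival time (k = 0,1,...) of the rate-1 Poisson clock at x;
  ch (x,k) = (destination of the oil, destination of the water) used if the k-th ring
  of the clock at x is a firing.\<close>

type_synonym 'v sample = "('v \<Rightarrow> nat \<times> nat) \<times> (('v \<times> nat) \<Rightarrow> real) \<times> (('v \<times> nat) \<Rightarrow> 'v \<times> 'v)"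

definition init_measure :: "nat pmf \<Rightarrow> ('v \<Rightarrow> nat \<times> nat) measure" where
  "init_measure \<nu> = (\<Pi>\<^sub>M x\<in>UNIV. measure_pmf (pair_pmf \<nu> \<nu>))"

definition clock_measure :: "(('v \<times> nat) \<Rightarrow> real) measure" where
  "clock_measure = (\<Pi>\<^sub>M i\<in>UNIV. density lborel (exponential_density 1))"

definition choice_measure :: "('v \<Rightarrow> 'v \<Rightarrow> bool) \<Rightarrow> (('v \<times> nat) \<Rightarrow> 'v \<times> 'v) measure" where
  "choice_measure E = (\<Pi>\<^sub>M i\<in>UNIV.
      measure_pmf (pair_pmf (pmf_of_set (nbrs E (fst i))) (pmf_of_set (nbrs E (fst i)))))"

definition OW_prob :: "('v \<Rightarrow> 'v \<Rightarrow> bool) \<Rightarrow> nat pmf \<Rightarrow> 'v sample measure" where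
  "OW_prob E \<nu> = init_measure \<nu> \<Otimes>\<^sub>M (clock_measure \<Otimes>\<^sub>M choice_measure E)"

definition ring :: "'v sample \<Rightarrow> 'v \<Rightarrow> nat \<Rightarrow> real" where
  "ring \<omega> x k = (\<Sum>i\<le>k. fst (snd \<omega>) (x, i))"

definition choice :: "'v sample \<Rightarrow> 'v \<Rightarrow> nat \<Rightarrow> 'v \<times> 'v" where
  "choice \<omega> x k = snd (snd \<omega>) (x, k)"

text \<open>F x k says whether the k-th ring at x is a firing.  Number of oils / waters at x strictly
  before time t, given the firing indicator F.\<close>
definition oil_before :: "'v sample \<Rightarrow> ('v \<Rightarrow> nat \<Rightarrow> bool) \<Rightarrow> 'v \<Rightarrow> real \<Rightarrow> int" where
  "oil_before \<omega> F x t =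
     int (fst (fst \<omega> x))
     + int (card {(y, k). ring \<omega> y k < t \<and> F y k \<and> fst (choice \<omega> y k) = x})
     - int (card {k. ring \<omega> x k < t \<and> F x k})"

definition water_before :: "'v sample \<Rightarrow> ('v \<Rightarrow> nat \<Rightarrow> bool) \<Rightarrow> 'v \<Rightarrow> real \<Rightarrow> int" where
  "water_before \<omega> F x t =
     int (snd (fst \<omega> x))
     + int (card {(y, k). ring \<omega> y k < t \<and> F y k \<and> snd (choice \<omega> y k) = x})
     - int (card {k. ring \<omega> x k < t \<and> F x k})"

definition OW_trajectory :: "'v sample \<Rightarrow> ('v \<Rightarrow> nat \<Rightarrow> bool) \<Rightarrow> bool" where
  "OW_trajectory \<omega> F \<longleftrightarrow>
     (\<forall>x k. F x k \<longleftrightarrow> oil_before \<omega> F x (ring \<omega> x k) \<ge> 1 \<and> water_before \<omega> F x (ring \<omega> x k) \<ge> 1)"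

definition firings :: "'v sample \<Rightarrow> ('v \<Rightarrow> nat \<Rightarrow> bool) \<Rightarrow> real \<Rightarrow> 'v \<Rightarrow> nat" where
  "firings \<omega> F t x = card {k. ring \<omega> x k \<le> t \<and> F x k}"

definition fixates :: "'v sample \<Rightarrow> ('v \<Rightarrow> nat \<Rightarrow> bool) \<Rightarrow> bool" where
  "fixates \<omega> F \<longleftrightarrow>
     (\<forall>A. finite A \<longrightarrow> (\<exists>\<tau>\<ge>0. \<forall>x\<in>A. \<forall>t>\<tau>. firings \<omega> F t x = firings \<omega> F \<tau> x))"

end

theory Submission
  imports Defs
begin

text \<open>
  For a vertex \<open>x\<close> let \<open>D\<close> be the number of oils minus the number of waters at \<open>x\<close>.  A firing
  at \<open>x\<close> itself leaves \<open>D\<close> unchanged, and a firing at a neighbour adds a symmetric increment in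
  \<open>{-1, 0, 1}\<close> that is independent of the past and nonzero with positive probability \<open>p\<close>.  Hence,
  for every integer \<open>a\<close>, the expectation of \<open>\<bar>D - a\<bar>\<close> grows by exactly \<open>p\<close> with each firing of
  that neighbour taking place while \<open>D = a\<close>.  On the other hand, by vertex-transitivity the
  expected numbers of oils and of waters at \<open>x\<close> do not depend on time, so the expectation of
  \<open>\<bar>D\<bar>\<close> stays bounded by \<open>\<mu>\<close>.  Therefore almost surely each value \<open>a\<close> is seen by
  only finitely many firings of neighbours.  If a neighbour fired infinitely often, \<open>\<bar>D\<bar>\<close> would
  tend to infinity, against Fatou's lemma.

  The dynamics is well defined because almost surely no infinite chain of rings goes backwards in
  time along edges: for small \<open>e\<close>, the vertices that ring in a time window of length \<open>e\<close> form a
  subcritical percolation, so all chains inside one window stay in a finite cluster.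
\<close>

section \<open>Product measures and finite clusters\<close>

text \<open>Independence of the past is used one ring at a time, without filtrations: the choice
  made at a single ring is integrated out while everything else is kept fixed. For this the firings
  have to be an explicit measurable function of the sample, hence the iterative construction of
  \<open>fires\<close>. Conservation of the mean is a balance of flows. By transitivity all vertices
  have the same expected number of firings before \<open>t\<close>. A vertex loses one oil and one
  water at each of its own firings, and gains on average \<open>1 / deg\<close> of each at every
  firing of each of its \<open>deg\<close> neighbours. Integrals take values in [0, \<infinity>], so
  losses are added rather than subtracted, and are cancelled because a clock rings finitely often in
  expectation before \<open>t\<close>. The final contradiction rests on \<open>D\<close> being
  frozen between firings of neighbours: its value at an integer time is the value seen by the next
  such firing. If \<bar>D\<bar> \<le> K at arbitrarily late integer times and a neighbour fires
  forever, then infinitely many firings see a value in [-K, K].\<close>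

lemma nn_integral_PiM_resample:
  fixes M :: "'i \<Rightarrow> 'a measure"
  assumes M: "\<And>j. prob_space (M j)"
    and f [measurable]: "f \<in> borel_measurable (PiM UNIV M)"
  shows "(\<integral>\<^sup>+w. f w \<partial>PiM UNIV M) = (\<integral>\<^sup>+w. (\<integral>\<^sup>+c. f (w(i := c)) \<partial>M i) \<partial>PiM UNIV M)"
proof -
  define N where "N = PiM (UNIV - {i}) M"
  interpret Mi: prob_space "M i" by (rule M)
  interpret N: prob_space N unfolding N_def by (intro prob_space_PiM M)
  interpret P: pair_sigma_finite "M i" N ..
  have ins: "insert i (UNIV - {i}) = UNIV" by auto
  have upd [measurable]: "(\<lambda>(c, X). X(i := c)) \<in> measurable (M i \<Otimes>\<^sub>M N) (PiM UNIV M)"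
    using measurable_add_dim[of i "UNIV - {i}" M] unfolding N_def ins
    by (subst measurable_pair_swap_iff) (simp add: case_prod_unfold)
  have D: "distr (M i \<Otimes>\<^sub>M N) (PiM UNIV M) (\<lambda>(c, X). X(i := c)) = PiM UNIV M"
    using distr_pair_PiM_eq_PiM[of "UNIV - {i}" M i] M unfolding N_def ins by simp
  have split: "(\<integral>\<^sup>+w. g w \<partial>PiM UNIV M) = (\<integral>\<^sup>+c. \<integral>\<^sup>+X. g (X(i := c)) \<partial>N \<partial>M i)"
    if [measurable]: "g \<in> borel_measurable (PiM UNIV M)" for g
  proof -
    have "(\<integral>\<^sup>+w. g w \<partial>PiM UNIV M) = (\<integral>\<^sup>+z. g ((\<lambda>(c, X). X(i := c)) z) \<partial>(M i \<Otimes>\<^sub>M N))"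
      by (subst D[symmetric], subst nn_integral_distr) auto
    also have "\<dots> = (\<integral>\<^sup>+c. \<integral>\<^sup>+X. g (X(i := c)) \<partial>N \<partial>M i)"
      by (subst N.nn_integral_fst[symmetric]) (auto simp: case_prod_unfold)
    finally show ?thesis .
  qed
  have upd2 [measurable]: "(\<lambda>(X, c). X(i := c)) \<in> measurable (PiM UNIV M \<Otimes>\<^sub>M M i) (PiM UNIV M)"
    using measurable_add_dim[of i UNIV M] by simp
  have m: "(\<lambda>w. \<integral>\<^sup>+c. f (w(i := c)) \<partial>M i) \<in> borel_measurable (PiM UNIV M)"
    by measurable
  have "(\<integral>\<^sup>+w. (\<integral>\<^sup>+c. f (w(i := c)) \<partial>M i) \<partial>PiM UNIV M)
      = (\<integral>\<^sup>+c. \<integral>\<^sup>+X. (\<integral>\<^sup>+c'. f (X(i := c')) \<partial>M i) \<partial>N \<partial>M i)"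
    by (subst split[OF m]) simp
  \<comment> \<open>The inner integral overwrites coordinate \<open>i\<close>, so it no longer
    depends on \<open>c\<close>, and \<open>M i\<close> has total mass 1.\<close>
  also have "\<dots> = (\<integral>\<^sup>+X. (\<integral>\<^sup>+c'. f (X(i := c')) \<partial>M i) \<partial>N)"
    by (simp add: Mi.emeasure_space_1)
  also have "\<dots> = (\<integral>\<^sup>+c'. \<integral>\<^sup>+X. f (X(i := c')) \<partial>N \<partial>M i)"
    by (subst P.Fubini') (simp_all add: case_prod_unfold)
  also have "\<dots> = (\<integral>\<^sup>+w. f w \<partial>PiM UNIV M)"
    by (rule split[OF f, symmetric])
  finally show ?thesis by simp
qed

text \<open>Meant for each of the three factors of \<open>OW_prob\<close> under a graph
  automorphism. The maps \<open>g j\<close> act on values: the identity for particle counts and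
  clocks, but jump destinations are vertices and must be moved together with the index. Preimages of
  cylinder sets are again cylinder sets, so it suffices to compare their masses.\<close>

lemma distr_PiM_relabel:
  fixes M :: "'i \<Rightarrow> 'a measure"
  assumes M: "\<And>j. prob_space (M j)" and p: "bij p"
    and g [measurable]: "\<And>j. g j \<in> measurable (M (p j)) (M j)"
    and d: "\<And>j. distr (M (p j)) (M j) (g j) = M j"
  shows "distr (PiM UNIV M) (PiM UNIV M) (\<lambda>w j. g j (w (p j))) = PiM UNIV M"
proof (rule measure_eqI_PiM_infinite)
  interpret P: prob_space "PiM UNIV M" by (intro prob_space_PiM M)
  have m [measurable]: "(\<lambda>w j. g j (w (p j))) \<in> measurable (PiM UNIV M) (PiM UNIV M)"
    by (rule measurable_PiM_single') (auto simp: space_PiM PiE_iff intro: measurable_space[OF g])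
  show "finite_measure (distr (PiM UNIV M) (PiM UNIV M) (\<lambda>w j. g j (w (p j))))"
    by (intro prob_space.finite_measure P.prob_space_distr m)
  fix A J assume J: "finite (J :: 'i set)" "J \<subseteq> UNIV" and A: "\<And>i. i \<in> J \<Longrightarrow> A i \<in> sets (M i)"
  define B where "B i = g (inv p i) -` A (inv p i) \<inter> space (M i)" for i
  have ip: "inv p (p j) = j" for j using p by (simp add: bij_is_inj)
  have Bp: "B (p j) = g j -` A j \<inter> space (M (p j))" for j unfolding B_def ip ..
  have B: "B i \<in> sets (M i)" if i: "i \<in> p ` J" for i
    using i A by (auto simp: Bp)
  have E: "prod_emb UNIV M J (Pi\<^sub>E J A) \<in> sets (PiM UNIV M)"
    using J A by (intro sets_PiM_I) auto
  have eq: "(\<lambda>w j. g j (w (p j))) -` prod_emb UNIV M J (Pi\<^sub>E J A) \<inter> space (PiM UNIV M)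
      = prod_emb UNIV M (p ` J) (Pi\<^sub>E (p ` J) B)"
    by (auto simp: prod_emb_def space_PiM Bp PiE_iff intro: measurable_space[OF g])
  have "emeasure (distr (PiM UNIV M) (PiM UNIV M) (\<lambda>w j. g j (w (p j)))) (prod_emb UNIV M J (Pi\<^sub>E J A))
      = emeasure (PiM UNIV M) (prod_emb UNIV M (p ` J) (Pi\<^sub>E (p ` J) B))"
    by (subst emeasure_distr[OF m E]) (simp add: eq)
  also have "\<dots> = (\<Prod>i\<in>p ` J. emeasure (M i) (B i))"
    using J B by (intro emeasure_PiM_emb M) auto
  also have "\<dots> = (\<Prod>j\<in>J. emeasure (M (p j)) (B (p j)))"
    using p by (subst prod.reindex) (auto intro: inj_on_subset[OF bij_is_inj])
  also have "\<dots> = (\<Prod>j\<in>J. emeasure (M j) (A j))"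
  proof (intro prod.cong refl)
    fix j assume "j \<in> J"
    have "emeasure (M j) (A j) = emeasure (distr (M (p j)) (M j) (g j)) (A j)" by (simp add: d)
    also have "\<dots> = emeasure (M (p j)) (B (p j))"
      using A[OF \<open>j \<in> J\<close>] by (simp add: emeasure_distr Bp)
    finally show "emeasure (M (p j)) (B (p j)) = emeasure (M j) (A j)" by simp
  qed
  also have "\<dots> = emeasure (PiM UNIV M) (prod_emb UNIV M J (Pi\<^sub>E J A))"
    using J A by (intro emeasure_PiM_emb[symmetric] M) auto
  finally show "emeasure (distr (PiM UNIV M) (PiM UNIV M) (\<lambda>w j. g j (w (p j)))) (prod_emb UNIV M J (Pi\<^sub>E J A))
      = emeasure (PiM UNIV M) (prod_emb UNIV M J (Pi\<^sub>E J A))" .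
qed auto

lemma indep_vars_PiM_component:
  fixes M :: "'i \<Rightarrow> 'a measure"
  assumes M: "\<And>j. prob_space (M j)"
  shows "prob_space.indep_vars (PiM UNIV M) M (\<lambda>i w. w i) UNIV"
proof -
  interpret P: prob_space "PiM UNIV M" by (intro prob_space_PiM M)
  show ?thesis
    by (subst P.indep_vars_iff_distr_eq_PiM) (auto simp: distr_PiM_component M restrict_UNIV distr_id[unfolded id_def])
qed

text \<open>A row consists of all coordinates attached to one vertex. Rows of distinct vertices are
  disjoint, so events read off from different rows are independent even if they involve infinitely
  many coordinates.\<close>

lemma prob_PiM_rows:
  fixes M :: "'v \<times> nat \<Rightarrow> 'a measure"
  assumes M: "\<And>j. prob_space (M j)" and J: "finite J"
    and B: "\<And>y. {Z \<in> space (PiM ({y} \<times> UNIV) M). Q y (\<lambda>k. Z (y, k))} \<in> sets (PiM ({y} \<times> UNIV) M)"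
  shows "measure (PiM UNIV M) {X \<in> space (PiM UNIV M). \<forall>y\<in>J. Q y (\<lambda>k. X (y, k))}
    = (\<Prod>y\<in>J. measure (PiM UNIV M) {X \<in> space (PiM UNIV M). Q y (\<lambda>k. X (y, k))})"
proof (cases "J = {}")
  case True
  interpret P: prob_space "PiM UNIV M" by (intro prob_space_PiM M)
  show ?thesis using True P.prob_space by simp
next
  case False
  interpret P: prob_space "PiM UNIV M" by (intro prob_space_PiM M)
  let ?R = "\<lambda>y X. \<lambda>i\<in>{y} \<times> UNIV. X i"
  let ?B = "\<lambda>y. {Z \<in> space (PiM ({y} \<times> UNIV) M). Q y (\<lambda>k. Z (y, k))}"
  have "P.indep_vars (\<lambda>y. PiM ({y} \<times> UNIV) M) ?R J"
    by (rule P.indep_vars_restrict[OF indep_vars_PiM_component[OF M]])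
      (auto simp: disjoint_family_on_def)
  then have "P.prob (\<Inter>y\<in>J. ?R y -` ?B y \<inter> space (PiM UNIV M))
      = (\<Prod>y\<in>J. P.prob (?R y -` ?B y \<inter> space (PiM UNIV M)))"
    using J False B by (intro P.indep_varsD[where I=J]) auto
  moreover have R: "?R y -` ?B y \<inter> space (PiM UNIV M) = {X \<in> space (PiM UNIV M). Q y (\<lambda>k. X (y, k))}" for y
    by (auto simp: space_PiM PiE_iff extensional_def)
  moreover have "(\<Inter>y\<in>J. ?R y -` ?B y \<inter> space (PiM UNIV M))
      = {X \<in> space (PiM UNIV M). \<forall>y\<in>J. Q y (\<lambda>k. X (y, k))}"
    unfolding R using False by auto
  ultimately show ?thesis by (simp only:)
qed

section \<open>Self-avoiding walks and percolation clusters\<close>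

lemma shortest_path_distinct:
  assumes xy: "(R ^^ m) x y" and min: "\<And>n. (R ^^ n) x y \<Longrightarrow> m \<le> n"
  obtains f where "f 0 = x" "f m = y" "\<And>i. i < m \<Longrightarrow> R (f i) (f (Suc i))" "inj_on f {..m}"
proof -
  obtain f where f: "f 0 = x" "f m = y" "\<And>i. i < m \<Longrightarrow> R (f i) (f (Suc i))"
    using xy unfolding relpowp_fun_conv by blast
  have pre: "(R ^^ i) x (f i)" if "i \<le> m" for i
    unfolding relpowp_fun_conv using f that by (intro exI[of _ f]) auto
  have post: "(R ^^ (m - j)) (f j) y" if "j \<le> m" for j
    unfolding relpowp_fun_conv using f that by (intro exI[of _ "\<lambda>i. f (i + j)"]) auto
  have "f i \<noteq> f j" if "i < j" "j \<le> m" for i j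
  proof
    assume "f i = f j"
    \<comment> \<open>Cutting out the loop between the two equal vertices leaves a path shorter than
      the minimum.\<close>
    then have "(R ^^ (i + (m - j))) x y"
      using pre[of i] post[of j] that unfolding relpowp_add by (metis less_imp_le order_trans relcomppI)
    with min[of "i + (m - j)"] that show False by simp
  qed
  then have "inj_on f {..m}"
    by (intro linorder_inj_onI) auto
  with f that show ?thesis by blast
qed

lemma finite_relpowp_ball:
  fixes R :: "'a \<Rightarrow> 'a \<Rightarrow> bool"
  assumes "\<And>a. finite {b. R a b}"
  shows "finite {y. (R ^^ n) x y}"
proof (induction n)
  case (Suc n)
  have "{y. (R ^^ Suc n) x y} = (\<Union>z\<in>{z. (R ^^ n) x z}. {b. R z b})" by auto
  then show ?case using Suc assms by simp
qed simp

text \<open>The start is left out of the list: in a cluster only the vertices that are entered have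
  to be open, not the one from which the exploration begins.\<close>

fun walks :: "('v \<Rightarrow> 'v \<Rightarrow> bool) \<Rightarrow> nat \<Rightarrow> 'v \<Rightarrow> 'v list set" where
  "walks E 0 x = {[]}"
| "walks E (Suc n) x = (\<Union>y\<in>nbrs E x. (#) y ` walks E n y)"

lemma finite_walks: "finite_degree E \<Longrightarrow> finite (walks E n x)"
  by (induction n arbitrary: x) (auto simp: finite_degree_def)

lemma card_walks:
  assumes "finite_degree E" and "\<And>x. card (nbrs E x) = d"
  shows "card (walks E n x) \<le> d ^ n"
proof (induction n arbitrary: x)
  case (Suc n)
  have "card (walks E (Suc n) x) \<le> (\<Sum>y\<in>nbrs E x. card ((#) y ` walks E n y))"
    using assms(1) by (auto simp: finite_degree_def intro!: card_UN_le)
  also have "\<dots> \<le> (\<Sum>y\<in>nbrs E x. d ^ n)"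
    by (intro sum_mono) (simp add: card_image Suc)
  also have "\<dots> = d ^ Suc n" by (simp add: assms)
  finally show ?case .
qed simp

lemma length_walks: "p \<in> walks E n x \<Longrightarrow> length p = n"
  by (induction n arbitrary: x p) auto

lemma map_upt_in_walks:
  assumes "\<And>i. i < n \<Longrightarrow> E (f i) (f (Suc i))"
  shows "map f [1..<Suc n] \<in> walks E n (f 0)"
  using assms
proof (induction n arbitrary: f)
  case (Suc n)
  have "map (\<lambda>i. f (Suc i)) [1..<Suc n] \<in> walks E n (f (Suc 0))"
    by (rule Suc.IH) (use Suc.prems in auto)
  moreover have "map f [1..<Suc (Suc n)] = f 1 # map (\<lambda>i. f (Suc i)) [1..<Suc n]"
    by (subst upt_conv_Cons) (auto simp: map_Suc_upt[symmetric] simp del: upt_Suc)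
  moreover have "f 1 \<in> nbrs E (f 0)" using Suc.prems[of 0] by (simp add: nbrs_def)
  ultimately show ?case by (auto simp del: upt_Suc)
qed simp

text \<open>Balls are finite, so an infinite cluster contains a vertex more than \<open>n\<close>
  steps away; the first \<open>n\<close> steps of a shortest path to it are self-avoiding.\<close>

lemma infinite_reach_walk:
  assumes E: "finite_degree E" and inf: "infinite {y. (\<lambda>a b. E a b \<and> A b)\<^sup>*\<^sup>* x y}"
  shows "\<exists>p\<in>walks E n x. distinct p \<and> (\<forall>y\<in>set p. A y)"
proof -
  define R where "R = (\<lambda>a b. E a b \<and> A b)"
  have fin: "finite {b. R a b}" for a
    using E by (rule_tac finite_subset[of _ "nbrs E a"]) (auto simp: R_def nbrs_def finite_degree_def)
  have "finite (\<Union>m\<le>n. {y. (R ^^ m) x y})" using finite_relpowp_ball[of R, OF fin] by auto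
  then obtain y where y: "R\<^sup>*\<^sup>* x y" "\<And>m. m \<le> n \<Longrightarrow> \<not> (R ^^ m) x y"
    using inf finite_subset[of "{y. R\<^sup>*\<^sup>* x y}" "\<Union>m\<le>n. {y. (R ^^ m) x y}"] unfolding R_def by blast
  define m where "m = (LEAST m. (R ^^ m) x y)"
  have "\<exists>m. (R ^^ m) x y" using y(1) by (simp add: rtranclp_power)
  then have m: "(R ^^ m) x y" "\<And>k. (R ^^ k) x y \<Longrightarrow> m \<le> k"
    unfolding m_def by (auto intro: LeastI_ex Least_le)
  then have "n < m" using y(2)[of m] by (cases "n < m") auto
  obtain f where f: "f 0 = x" "\<And>i. i < m \<Longrightarrow> R (f i) (f (Suc i))" "inj_on f {..m}"
    using shortest_path_distinct[OF m] by metis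
  have "map f [1..<Suc n] \<in> walks E n x"
    using map_upt_in_walks[of n E f] f \<open>n < m\<close> by (auto simp: R_def)
  moreover have "distinct (map f [1..<Suc n])"
    unfolding distinct_map using \<open>n < m\<close>
    by (intro conjI distinct_upt inj_on_subset[OF f(3)] subsetI) (simp del: upt_Suc)
  moreover have "A (f i)" if "i \<in> {1..<Suc n}" for i
    using f(2)[of "i - 1"] that \<open>n < m\<close> by (cases i) (auto simp: R_def)
  then have "\<forall>y\<in>set (map f [1..<Suc n]). A y" unfolding set_map set_upt by blast
  ultimately show ?thesis by blast
qed

text \<open>First moment bound for subcritical percolation: there are at most \<open>d ^ n\<close>
  walks of length \<open>n\<close>, and a self-avoiding one visits exactly \<open>n\<close>
  vertices, hence is open with probability at most \<open>q ^ n\<close>.\<close>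

lemma (in prob_space) AE_finite_reach:
  assumes E: "finite_degree E" "\<And>x. card (nbrs E x) = d"
    and A [measurable]: "\<And>y. {w \<in> space M. A y w} \<in> events"
    and q: "\<And>J. finite J \<Longrightarrow> prob {w \<in> space M. \<forall>y\<in>J. A y w} \<le> q ^ card J"
    and dq: "0 \<le> q" "d * q < 1"
  shows "AE w in M. finite {y. (\<lambda>a b. E a b \<and> A b w)\<^sup>*\<^sup>* x y}"
proof -
  define U where "U n = (\<Union>p\<in>{p\<in>walks E n x. distinct p}. {w \<in> space M. \<forall>y\<in>set p. A y w})" for n
  have fw: "finite {p\<in>walks E n x. distinct p}" for n using finite_walks[OF E(1)] by auto
  have Um [measurable]: "U n \<in> events" for n
    unfolding U_def using fw by (intro sets.finite_UN) auto
  have "prob (U n) \<le> (real d * q) ^ n" for n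
  proof -
    have "prob (U n) \<le> (\<Sum>p\<in>{p\<in>walks E n x. distinct p}. prob {w \<in> space M. \<forall>y\<in>set p. A y w})"
      unfolding U_def using fw by (intro finite_measure_subadditive_finite) auto
    also have "\<dots> \<le> (\<Sum>p\<in>{p\<in>walks E n x. distinct p}. q ^ n)"
    proof (intro sum_mono)
      fix p assume "p \<in> {p\<in>walks E n x. distinct p}"
      then have "card (set p) = n" by (auto simp: distinct_card dest: length_walks)
      then show "prob {w \<in> space M. \<forall>y\<in>set p. A y w} \<le> q ^ n" using q[of "set p"] by simp
    qed
    also have "\<dots> = real (card {p\<in>walks E n x. distinct p}) * q ^ n" by simp
    also have "\<dots> \<le> real d ^ n * q ^ n"
    proof (intro mult_right_mono)
      have "card {p\<in>walks E n x. distinct p} \<le> card (walks E n x)"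
        using finite_walks[OF E(1)] by (intro card_mono) auto
      also have "\<dots> \<le> d ^ n" by (rule card_walks[OF E])
      finally show "real (card {p\<in>walks E n x. distinct p}) \<le> real d ^ n"
        by (metis of_nat_le_iff of_nat_power)
    qed (use dq in auto)
    finally show ?thesis by (simp add: power_mult_distrib)
  qed
  then have "prob (\<Inter>n. U n) \<le> (real d * q) ^ n" for n
    using finite_measure_mono[of "\<Inter>n. U n" "U n"] by (auto intro: order_trans)
  moreover have "(\<lambda>n. (real d * q) ^ n) \<longlonglongrightarrow> 0" using dq by (intro LIMSEQ_realpow_zero) auto
  ultimately have "prob (\<Inter>n. U n) \<le> 0" by (intro LIMSEQ_le_const) auto
  then have "prob (\<Inter>n. U n) = 0" using measure_nonneg[of M] by (intro antisym) auto
  then have "AE w in M. w \<notin> (\<Inter>n. U n)"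
    by (subst prob_eq_0[symmetric]) auto
  moreover have "AE w in M. w \<in> space M" by (rule AE_space)
  ultimately show ?thesis
  proof (eventually_elim, rule_tac ccontr)
    fix w assume w: "w \<notin> (\<Inter>n. U n)" "infinite {y. (\<lambda>a b. E a b \<and> A b w)\<^sup>*\<^sup>* x y}" "w \<in> space M"
    show False
      using infinite_reach_walk[OF E(1) w(2)] w(1,3) unfolding U_def by blast
  qed
qed

lemma (in finite_measure) AE_finite_of_suminf:
  assumes P [measurable]: "\<And>k :: nat. {w \<in> space M. P k w} \<in> sets M"
    and fin: "(\<Sum>k. emeasure M {w \<in> space M. P k w}) < \<infinity>"
  shows "AE w in M. finite {k. P k w}"
proof -
  have "summable (\<lambda>k. measure M {w \<in> space M. P k w})"
    using fin by (intro summable_suminf_not_top) (auto simp: emeasure_eq_measure)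
  then have "AE w in M. eventually (\<lambda>k. w \<in> space M - {w \<in> space M. P k w}) sequentially"
    by (intro borel_cantelli_AE1) (auto simp: less_top[symmetric])
  then show ?thesis
  proof eventually_elim
    fix w assume "eventually (\<lambda>k. w \<in> space M - {w \<in> space M. P k w}) sequentially"
    then obtain N where N: "\<And>k. N \<le> k \<Longrightarrow> \<not> P k w" unfolding eventually_sequentially by auto
    have "{k. P k w} \<subseteq> {..<N}" using N not_less by auto
    then show "finite {k. P k w}" by (rule finite_subset) simp
  qed
qed

section \<open>The Poisson clocks\<close>

text \<open>The ring times as a function of the clock coordinate alone, so that facts about clocks
  can be proved under \<open>clock_measure\<close> and transported to
  \<open>OW_prob\<close>.\<close>

definition ring_time :: "('v \<times> nat \<Rightarrow> real) \<Rightarrow> 'v \<Rightarrow> nat \<Rightarrow> real" where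
  "ring_time S x k = (\<Sum>i\<le>k. S (x, i))"

lemma ring_eq_ring_time: "ring w x k = ring_time (fst (snd w)) x k"
  by (simp add: ring_def ring_time_def)

interpretation clock: prob_space clock_measure
  unfolding clock_measure_def by (intro prob_space_PiM prob_space_exponential_density) simp

lemma clock_component_measurable: "(\<lambda>S. S i) \<in> borel_measurable clock_measure"
proof -
  have "(\<lambda>S. S i) \<in> measurable clock_measure (density lborel (exponential_density 1))"
    unfolding clock_measure_def by (rule measurable_component_singleton) simp
  also have "measurable clock_measure (density lborel (exponential_density 1)) = borel_measurable clock_measure"
    by (intro measurable_cong_sets) simp_all
  finally show ?thesis .
qed

lemma space_clock [simp]: "space clock_measure = UNIV"
  unfolding clock_measure_def by (simp add: space_PiM)

lemma ring_time_measurable [measurable]: "(\<lambda>S. ring_time S x k) \<in> borel_measurable clock_measure"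
  unfolding ring_time_def by (intro borel_measurable_sum clock_component_measurable)

lemma ring_time_events:
  assumes "A \<in> sets borel"
  shows "{S. ring_time S x k \<in> A} \<in> clock.events"
  using measurable_sets[OF ring_time_measurable assms, of x k] by (simp add: vimage_def)

text \<open>Rings are numbered from 0, so ring \<open>k\<close> is a sum of \<open>k + 1\<close>
  independent exponential times. The density \<open>erlang_density k\<close> is the gamma density of
  shape \<open>k + 1\<close>, so the indices agree.\<close>

lemma ring_time_distributed:
  "distributed clock_measure lborel (\<lambda>S. ring_time S x k) (erlang_density k 1)"
proof -
  have e: "prob_space (density lborel (exponential_density 1))"
    by (intro prob_space_exponential_density) simp
  let ?I = "{x} \<times> {..k}"
  have "clock.indep_vars (\<lambda>_. borel) (\<lambda>i S. S i) ?I"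
  proof -
    have "clock.indep_vars (\<lambda>_. density lborel (exponential_density 1)) (\<lambda>i S. S i) UNIV"
      unfolding clock_measure_def by (rule indep_vars_PiM_component[OF e])
    then have "clock.indep_vars (\<lambda>_. density lborel (exponential_density 1)) (\<lambda>i S. S i) ?I"
      by (rule clock.indep_vars_subset) auto
    then have "clock.indep_vars (\<lambda>_. borel) (\<lambda>i S. (\<lambda>x. x) (S i)) ?I"
      by (rule clock.indep_vars_compose2) auto
    then show ?thesis .
  qed
  moreover have "distributed clock_measure lborel (\<lambda>S. S i) (exponential_density 1)" for i
    unfolding distributed_def
  proof (intro conjI)
    show "distr clock_measure lborel (\<lambda>S. S i) = density lborel (exponential_density 1)"
      unfolding clock_measure_def
      using distr_PiM_component[of UNIV "\<lambda>_. density lborel (exponential_density 1)" i] e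
      by (simp cong: distr_cong)
  qed (auto simp: clock_component_measurable)
  ultimately have "distributed clock_measure lborel (\<lambda>S. \<Sum>i\<in>?I. S i) (erlang_density (card ?I - 1) 1)"
    by (intro clock.exponential_distributed_sum) auto
  moreover have "(\<Sum>i\<in>?I. S i) = ring_time S x k" for S :: "'a \<times> nat \<Rightarrow> real"
    unfolding ring_time_def by (rule sum.reindex_cong[of "\<lambda>i. (x, i)"]) (auto simp: inj_on_def)
  ultimately show ?thesis by (simp add: card_cartesian_product)
qed

text \<open>The densities of the successive rings are the Poisson weights
  \<open>exp (- x) * x ^ k / fact k\<close>, and the exponential series adds them up to 1.\<close>

lemma suminf_erlang_density:
  "(\<Sum>k. ennreal (erlang_density k 1 x)) = indicator {0..} x"
proof (cases "x < 0")
  case False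
  have "(\<lambda>k. x ^ k /\<^sub>R fact k * exp (- x)) sums (exp x * exp (- x))"
    by (intro sums_mult2 exp_converges)
  then have "(\<lambda>k. erlang_density k 1 x) sums 1"
    using False by (simp add: erlang_density_def field_simps exp_minus_inverse)
  then show ?thesis
    using False by (subst suminf_ennreal_eq[of _ 1]) auto
qed (simp add: erlang_density_def)

text \<open>The intensity of a rate-1 Poisson process is Lebesgue measure on the half-line. This
  yields local finiteness of the rings, the small probability of ringing in a short window, and
  finiteness of the expected number of firings.\<close>

lemma expected_rings:
  assumes A [measurable]: "A \<in> sets borel"
  shows "(\<Sum>k. emeasure clock_measure {S. ring_time S x k \<in> A}) = emeasure lborel (A \<inter> {0..})"
proof -
  have "emeasure clock_measure {S. ring_time S x k \<in> A}
      = (\<integral>\<^sup>+t. ennreal (erlang_density k 1 t) * indicator A t \<partial>lborel)" for k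
    using distributed_emeasure[OF ring_time_distributed[of x k], of A] A by (simp add: vimage_def)
  then have "(\<Sum>k. emeasure clock_measure {S. ring_time S x k \<in> A})
      = (\<integral>\<^sup>+t. (\<Sum>k. ennreal (erlang_density k 1 t) * indicator A t) \<partial>lborel)"
    by (simp only:, subst nn_integral_suminf) auto
  also have "\<dots> = (\<integral>\<^sup>+t. indicator (A \<inter> {0..}) t \<partial>lborel)"
    by (intro nn_integral_cong) (simp add: suminf_erlang_density indicator_inter_arith mult.commute ennreal_suminf_multc)
  finally show ?thesis by simp
qed

section \<open>Almost sure properties of the clocks\<close>

lemma AE_clock_pos:
  assumes "countable (UNIV :: 'v set)"
  shows "AE S in clock_measure. \<forall>i :: 'v \<times> nat. 0 < S i"
proof -
  have c: "countable (UNIV :: ('v \<times> nat) set)" using assms by (simp flip: UNIV_Times_UNIV)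
  have p: "AE t in density lborel (exponential_density 1). 0 < (t :: real)"
    using AE_lborel_singleton[of "0::real"]
    by (subst AE_density) (auto simp: erlang_density_def)
  have "AE S in clock_measure. 0 < S i" for i :: "'v \<times> nat"
    unfolding clock_measure_def
    using prob_space_exponential_density p by (intro AE_PiM_component) auto
  then have "AE S in clock_measure. \<forall>i :: 'v \<times> nat\<in>UNIV. 0 < S i"
    unfolding AE_ball_countable[OF c] by blast
  then show ?thesis by (simp only: ball_UNIV)
qed

lemma AE_clock_finite_rings:
  assumes "countable (UNIV :: 'v set)"
  shows "AE S in clock_measure. \<forall>(x :: 'v) T. finite {k. ring_time S x k < T}"
proof -
  have "AE S in clock_measure. finite {k. ring_time S x k < real n}" for x :: 'v and n :: nat
  proof -
    have "{..<real n} \<inter> {0..} = {0..<real n}" by auto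
    then have "(\<Sum>k. emeasure clock_measure {S. ring_time S x k \<in> {..<real n}}) = ennreal (real n)"
      by (subst expected_rings) auto
    then have "(\<Sum>k. emeasure clock_measure {S. ring_time S x k < real n}) < \<infinity>"
      by simp
    then show ?thesis
      using ring_time_events[of "{..<real n}" x]
      by (intro clock.AE_finite_of_suminf) (simp_all only: space_clock UNIV_I simp_thms lessThan_iff borel_open open_lessThan)
  qed
  then have "AE S in clock_measure. \<forall>(x :: 'v)\<in>UNIV. \<forall>n. finite {k. ring_time S x k < real n}"
    by (intro AE_ball_countable[THEN iffD2, OF assms] ballI AE_all_countable[THEN iffD2] allI)
  then show ?thesis
  proof eventually_elim
    fix S assume S: "\<forall>x :: 'v\<in>UNIV. \<forall>n. finite {k. ring_time S x k < real n}"
    show "\<forall>(x :: 'v) T. finite {k. ring_time S x k < T}"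
    proof safe
      fix x :: 'v and T :: real
      obtain n where "T \<le> real n" using real_arch_simple by blast
      then show "finite {k. ring_time S x k < T}"
        using S by (auto intro: finite_subset[of _ "{k. ring_time S x k < real n}"])
    qed
  qed
qed

text \<open>Resampling the first waiting time at \<open>x\<close> shifts all rings of
  \<open>x\<close> and none of \<open>y\<close>. A tie would force the new waiting time to hit a
  single point, and the exponential law has no atoms.\<close>

lemma AE_clock_no_ties:
  assumes c: "countable (UNIV :: 'v set)"
  shows "AE S in clock_measure. \<forall>(x :: 'v) y j k. x \<noteq> y \<longrightarrow> ring_time S x j \<noteq> ring_time S y k"
proof -
  have e: "prob_space (density lborel (exponential_density 1))"
    by (intro prob_space_exponential_density) simp
  have "AE S in clock_measure. ring_time S x j \<noteq> ring_time S y k" if "x \<noteq> y" for x y :: 'v and j k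
  proof -
    let ?f = "\<lambda>S. indicator {S. ring_time S x j = ring_time S y k} S :: ennreal"
    have "{S \<in> space clock_measure. ring_time S x j = ring_time S y k} \<in> clock.events"
      by (intro borel_measurable_eq ring_time_measurable)
    then have fm: "?f \<in> borel_measurable clock_measure"
      by (intro borel_measurable_indicator) simp
    have eq: "?f (S((x, 0) := t)) = indicator {ring_time S y k - ring_time S x j + S (x, 0)} t" for S t
    proof -
      have "ring_time (S((x, 0) := t)) y k = ring_time S y k"
        using that by (simp add: ring_time_def)
      moreover have "ring_time S' x j = S' (x, 0) + (\<Sum>i\<in>{1..j}. S' (x, i))" for S'
        unfolding ring_time_def by (simp add: atMost_atLeast0 sum.atLeast_Suc_atMost)
      moreover have "(\<Sum>i\<in>{1..j}. (S((x, 0) := t)) (x, i)) = (\<Sum>i\<in>{1..j}. S (x, i))"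
        by (intro sum.cong) auto
      ultimately show ?thesis by (auto simp: indicator_def)
    qed
    have "(\<integral>\<^sup>+S. ?f S \<partial>clock_measure)
        = (\<integral>\<^sup>+S. (\<integral>\<^sup>+t. ?f (S((x, 0) := t)) \<partial>density lborel (exponential_density 1)) \<partial>clock_measure)"
      unfolding clock_measure_def
      by (rule nn_integral_PiM_resample[OF e fm[unfolded clock_measure_def]])
    also have "\<dots> = 0"
      unfolding eq by (simp add: emeasure_density nn_integral_density)
    finally have "AE S in clock_measure. ?f S = 0"
      unfolding nn_integral_0_iff_AE[OF fm] .
    then show ?thesis
      by (rule eventually_mono) (simp split: split_indicator_asm)
  qed
  then have "AE S in clock_measure. \<forall>(x :: 'v)\<in>UNIV. \<forall>y\<in>UNIV. \<forall>j k. x \<noteq> y \<longrightarrow> ring_time S x j \<noteq> ring_time S y k"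
    by (intro AE_ball_countable[THEN iffD2, OF c] ballI AE_all_countable[THEN iffD2] allI AE_impI)
  then show ?thesis by simp
qed

text \<open>The probability of ringing in a window is at most the expected number of rings there,
  which is the window length \<open>e\<close>; clocks of different vertices are independent, so the
  bound multiplies.\<close>

lemma AE_clock_windows:
  fixes e :: real
  assumes c: "countable (UNIV :: 'v set)"
    and E: "finite_degree E" "\<And>x :: 'v. card (nbrs E x) = d" and e: "0 < e" "d * e < 1"
  shows "AE S in clock_measure. \<forall>x (j :: nat).
     finite {y. (\<lambda>a b. E a b \<and> (\<exists>k. ring_time S b k \<in> {j * e..<(real j + 1) * e}))\<^sup>*\<^sup>* x y}"
proof -
  have "AE S in clock_measure. finite {y. (\<lambda>a b. E a b \<and> (\<exists>k. ring_time S b k \<in> {j * e..<(real j + 1) * e}))\<^sup>*\<^sup>* x y}"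
    for x and j :: nat
  proof (rule clock.AE_finite_reach[OF E, where q=e])
    let ?A = "\<lambda>y S. \<exists>k. ring_time S y k \<in> {j * e..<(real j + 1) * e}"
    fix y show "{S \<in> space clock_measure. ?A y S} \<in> clock.events" by measurable
  next
    let ?A = "\<lambda>y S. \<exists>k. ring_time S y k \<in> {j * e..<(real j + 1) * e}"
    fix J :: "'v set" assume J: "finite J"
    have p: "prob_space (density lborel (exponential_density 1))"
      by (intro prob_space_exponential_density) simp
    have "clock.prob {S \<in> space clock_measure. \<forall>y\<in>J. ?A y S}
        = (\<Prod>y\<in>J. clock.prob {S \<in> space clock_measure. ?A y S})"
      unfolding clock_measure_def ring_time_def
      by (rule prob_PiM_rows[where M="\<lambda>_. density lborel (exponential_density 1)" and Q="\<lambda>y s. \<exists>k. (\<Sum>i\<le>k. s i) \<in> {j * e..<(real j + 1) * e}"])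
        (rule p, rule J, measurable)
    also have "\<dots> \<le> (\<Prod>y\<in>J. e)"
    proof (intro prod_mono conjI measure_nonneg)
      fix y
      have "emeasure clock_measure {S \<in> space clock_measure. ?A y S}
          = emeasure clock_measure (\<Union>k. {S. ring_time S y k \<in> {j * e..<(real j + 1) * e}})"
        by (intro arg_cong2[where f=emeasure]) auto
      also have "\<dots> \<le> (\<Sum>k. emeasure clock_measure {S. ring_time S y k \<in> {j * e..<(real j + 1) * e}})"
        by (intro emeasure_subadditive_countably image_subsetI ring_time_events) simp
      also have "\<dots> = emeasure lborel ({j * e..<(real j + 1) * e} \<inter> {0..})"
        by (rule expected_rings) simp
      also have "{j * e..<(real j + 1) * e} \<inter> {0..} = {j * e..<(real j + 1) * e}" 
        using e by (auto intro: order_trans[of 0 "j * e"])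
      also have "emeasure lborel \<dots> = e" using e by (simp add: algebra_simps)
      finally show "clock.prob {S \<in> space clock_measure. ?A y S} \<le> e"
        using e by (simp add: clock.emeasure_eq_measure)
    qed
    finally show "clock.prob {S \<in> space clock_measure. \<forall>y\<in>J. ?A y S} \<le> e ^ card J" by simp
  qed (use e in auto)
  then have "AE S in clock_measure. \<forall>x\<in>UNIV. \<forall>j :: nat.
     finite {y. (\<lambda>a b. E a b \<and> (\<exists>k. ring_time S b k \<in> {j * e..<(real j + 1) * e}))\<^sup>*\<^sup>* x y}"
    by (intro AE_ball_countable[THEN iffD2, OF c] ballI AE_all_countable[THEN iffD2] allI)
  then show ?thesis by simp
qed

text \<open>The rings on which the outcome of a given ring depends directly: only firings at the
  vertex itself or at a neighbour change its numbers of particles.\<close>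

definition earlier :: "('v \<Rightarrow> 'v \<Rightarrow> bool) \<Rightarrow> ('v \<times> nat \<Rightarrow> real) \<Rightarrow> (('v \<times> nat) \<times> ('v \<times> nat)) set" where
  "earlier E S = {((y, j), (x, k)). (y = x \<or> E x y) \<and> ring_time S y j < ring_time S x k}"

text \<open>Along an infinite descending chain the index of the time window is a nonincreasing
  natural number, hence eventually constant. From then on the chain stays in one finite cluster,
  where only finitely many rings are available, although its ring times are all distinct.\<close>

lemma wf_earlier:
  fixes e :: real
  assumes nn: "\<And>x k. 0 \<le> ring_time S x k" and fin: "\<And>x T. finite {k. ring_time S x k < T}" and e: "0 < e"
    and win: "\<And>x (j :: nat). finite {y. (\<lambda>a b. E a b \<and> (\<exists>k. ring_time S b k \<in> {j * e..<(real j + 1) * e}))\<^sup>*\<^sup>* x y}"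
  shows "wf (earlier E S)"
proof (rule ccontr)
  assume "\<not> wf (earlier E S)"
  then obtain p where p: "\<And>n :: nat. (p (Suc n), p n) \<in> earlier E S"
    unfolding wf_iff_no_infinite_down_chain by blast
  define v r where "v n = fst (p n)" and "r n = ring_time S (fst (p n)) (snd (p n))" for n
  have step: "v (Suc n) = v n \<or> E (v n) (v (Suc n))" "r (Suc n) < r n" for n
    using p[of n] unfolding earlier_def v_def r_def by (auto simp: case_prod_unfold)
  have dec: "r n < r m" if "m < n" for m n
    using that by (induction n) (use step(2) in \<open>auto simp: less_Suc_eq intro: order.strict_trans\<close>)
  define w where "w n = nat \<lfloor>r n / e\<rfloor>" for n
  define N where "N = (ARG_MIN w n. True)"
  have N: "w N \<le> w n" for n unfolding N_def by (rule arg_min_nat_le) simp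
  have wN: "w n = w N" if "N \<le> n" for n
  proof -
    have "r n \<le> r N" using dec[of N n] that by (cases "n = N") auto
    then have "w n \<le> w N" unfolding w_def using e by (intro nat_mono floor_mono divide_right_mono) auto
    with N[of n] show ?thesis by simp
  qed
  have rw: "r n \<in> {w N * e..<(real (w N) + 1) * e}" if "N \<le> n" for n
  proof -
    have "0 \<le> r n / e" using nn e unfolding r_def by simp
    then have "real (w n) \<le> r n / e" "r n / e < real (w n) + 1"
      unfolding w_def by (auto simp: of_nat_nat)
    then show ?thesis using wN[OF that] e by (simp add: field_simps)
  qed
  let ?R = "\<lambda>a b. E a b \<and> (\<exists>k. ring_time S b k \<in> {w N * e..<(real (w N) + 1) * e})"
  have reach: "?R\<^sup>*\<^sup>* (v N) (v (N + n))" for n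
  proof (induction n)
    case (Suc n)
    show ?case
    proof (cases "v (Suc (N + n)) = v (N + n)")
      case False
      then have "?R (v (N + n)) (v (Suc (N + n)))"
        using step(1)[of "N + n"] rw[of "Suc (N + n)"] unfolding r_def v_def by auto
      with Suc show ?thesis by (auto intro: rtranclp.rtrancl_into_rtrancl)
    qed (use Suc in simp)
  qed simp
  let ?V = "{y. ?R\<^sup>*\<^sup>* (v N) y}"
  \<comment> \<open>The \<open>+ 1\<close> lets the strict bound admit \<open>p N\<close>
    itself.\<close>
  have "p n \<in> (SIGMA y:?V. {k. ring_time S y k < r N + 1})" if "N \<le> n" for n
  proof -
    have "r n \<le> r N" using dec[of N n] that by (cases "n = N") auto
    moreover have "v n \<in> ?V" using reach[of "n - N"] that by simp
    ultimately have "(v n, snd (p n)) \<in> (SIGMA y:?V. {k. ring_time S y k < r N + 1})"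
      unfolding r_def v_def[symmetric] by (intro SigmaI) auto
    then show ?thesis unfolding v_def by simp
  qed
  then have "p ` {N..} \<subseteq> (SIGMA y:?V. {k. ring_time S y k < r N + 1})"
    by (intro image_subsetI) (simp only: atLeast_iff)
  moreover have "finite (SIGMA y:?V. {k. ring_time S y k < r N + 1})"
    by (intro finite_SigmaI win fin)
  ultimately have "finite (p ` {N..})" by (rule finite_subset)
  moreover have "inj_on p {N..}"
    by (rule linorder_inj_onI) (use dec r_def in \<open>force+\<close>)
  ultimately show False using infinite_Ici finite_imageD by blast
qed

section \<open>Deterministic dynamics\<close>

text \<open>Oils are coded by \<^term>\<open>True\<close>, waters by \<^term>\<open>False\<close>.\<close>

definition side :: "bool \<Rightarrow> 'a \<times> 'a \<Rightarrow> 'a" where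
  "side b p = (if b then fst p else snd p)"

definition departures :: "'v sample \<Rightarrow> ('v \<Rightarrow> nat \<Rightarrow> bool) \<Rightarrow> 'v \<Rightarrow> real \<Rightarrow> nat" where
  "departures w F y t = card {k. ring w y k < t \<and> F y k}"

definition arrivals :: "bool \<Rightarrow> 'v sample \<Rightarrow> ('v \<Rightarrow> nat \<Rightarrow> bool) \<Rightarrow> 'v \<Rightarrow> 'v \<Rightarrow> real \<Rightarrow> nat" where
  "arrivals b w F y x t = card {k. ring w y k < t \<and> F y k \<and> side b (choice w y k) = x}"

text \<open>Arrivals are summed over the neighbours, which makes the stock a finite sum of
  measurable counts for every sample. It agrees with \<open>oil_before\<close> and
  \<open>water_before\<close> once all choices are neighbours.\<close>

definition stock :: "('v \<Rightarrow> 'v \<Rightarrow> bool) \<Rightarrow> bool \<Rightarrow> 'v sample \<Rightarrow> ('v \<Rightarrow> nat \<Rightarrow> bool) \<Rightarrow> 'v \<Rightarrow> real \<Rightarrow> int" where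
  "stock E b w F x t = int (side b (fst w x)) + (\<Sum>y\<in>nbrs E x. int (arrivals b w F y x t))
     - int (departures w F x t)"

fun approx_fires :: "('v \<Rightarrow> 'v \<Rightarrow> bool) \<Rightarrow> 'v sample \<Rightarrow> nat \<Rightarrow> 'v \<Rightarrow> nat \<Rightarrow> bool" where
  "approx_fires E w 0 x k = False"
| "approx_fires E w (Suc n) x k = (\<forall>b. 1 \<le> stock E b w (approx_fires E w n) x (ring w x k))"

text \<open>The rings earlier than a given ring at or next to its vertex form a finite set, and the relation
  is well-founded, so the iteration from the empty set of firings stabilizes at every ring, although
  it is not monotone.\<close>

definition fires :: "('v \<Rightarrow> 'v \<Rightarrow> bool) \<Rightarrow> 'v sample \<Rightarrow> 'v \<Rightarrow> nat \<Rightarrow> bool" where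
  "fires E w x k \<longleftrightarrow> (\<exists>N. \<forall>n\<ge>N. approx_fires E w n x k)"

text \<open>The \<open>D\<close> of the overview just before time \<open>t\<close>: firings at time
  \<open>t\<close> are not yet counted, so at a ring this is the value that the ring sees.\<close>

definition gap :: "('v \<Rightarrow> 'v \<Rightarrow> bool) \<Rightarrow> 'v sample \<Rightarrow> 'v \<Rightarrow> real \<Rightarrow> int" where
  "gap E w x t = stock E True w (fires E w) x t - stock E False w (fires E w) x t"

section \<open>Locality of the dynamics\<close>

lemma stock_cong:
  assumes "fst w x = fst w' x"
    and "\<And>y k. y = x \<or> E x y \<Longrightarrow> ring w y k < t \<and> F y k \<longleftrightarrow> ring w' y k < t \<and> F' y k"
    and "\<And>y k. E x y \<Longrightarrow> ring w y k < t \<Longrightarrow> F y k \<Longrightarrow> choice w y k = choice w' y k"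
  shows "stock E b w F x t = stock E b w' F' x t"
proof -
  have "{k. ring w y k < t \<and> F y k \<and> side b (choice w y k) = x}
      = {k. ring w' y k < t \<and> F' y k \<and> side b (choice w' y k) = x}" if "y \<in> nbrs E x" for y
    using assms(2,3)[of y] that unfolding nbrs_def by (auto; metis)
  moreover have "{k. ring w x k < t \<and> F x k} = {k. ring w' x k < t \<and> F' x k}"
    using assms(2)[of x] by auto
  ultimately show ?thesis
    unfolding stock_def arrivals_def departures_def using assms(1) by simp
qed

text \<open>Choices made at a ring cannot influence whether that ring, or an earlier one, is a firing.
  This is the independence of the past used in the resampling argument.\<close>

lemma approx_fires_local:
  assumes "fst w = fst w'" "fst (snd w) = fst (snd w')"
    and ch: "\<And>y k. ring w y k < T \<Longrightarrow> choice w y k = choice w' y k"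
  shows "ring w x k \<le> T \<Longrightarrow> approx_fires E w n x k = approx_fires E w' n x k"
proof (induction n arbitrary: x k)
  case (Suc n)
  have r: "ring w = ring w'" by (intro ext) (simp only: ring_eq_ring_time assms(2))
  have "stock E b w (approx_fires E w n) x (ring w x k) = stock E b w' (approx_fires E w' n) x (ring w' x k)" for b
    unfolding r by (rule stock_cong) (use Suc assms r in auto)
  then show ?case by simp
qed simp

lemma fires_local:
  assumes "fst w = fst w'" "fst (snd w) = fst (snd w')"
    and "\<And>y k. ring w y k < T \<Longrightarrow> choice w y k = choice w' y k"
  shows "ring w x k \<le> T \<Longrightarrow> fires E w x k = fires E w' x k"
  unfolding fires_def using approx_fires_local[OF assms] by blast

lemma gap_local:
  assumes "fst w = fst w'" "fst (snd w) = fst (snd w')"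
    and "\<And>y k. ring w y k < T \<Longrightarrow> choice w y k = choice w' y k"
  shows "gap E w x T = gap E w' x T"
proof -
  have r: "ring w = ring w'" by (intro ext) (simp only: ring_eq_ring_time assms(2))
  have "stock E b w (fires E w) x T = stock E b w' (fires E w') x T" for b
    by (rule stock_cong) (use fires_local[OF assms] assms r in auto)
  then show ?thesis by (simp add: gap_def)
qed

text \<open>The action of an automorphism \<open>f\<close> on samples: the new sample does at
  \<open>f x\<close> what the old one does at \<open>x\<close>, with destinations moved by
  \<open>f\<close> as well.\<close>

definition relabel :: "('v \<Rightarrow> 'v) \<Rightarrow> 'v sample \<Rightarrow> 'v sample" where
  "relabel f w = (\<lambda>x. fst w (inv f x), \<lambda>i. fst (snd w) (inv f (fst i), snd i),
     \<lambda>i. map_prod f f (snd (snd w) (inv f (fst i), snd i)))"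

lemma ring_relabel: "bij f \<Longrightarrow> ring (relabel f w) (f x) k = ring w x k"
  by (simp add: ring_def relabel_def bij_is_inj)

lemma choice_relabel: "bij f \<Longrightarrow> choice (relabel f w) (f x) k = map_prod f f (choice w x k)"
  by (simp add: choice_def relabel_def bij_is_inj)

lemma side_map_prod: "side b (map_prod f f p) = f (side b p)"
  by (simp add: side_def)

lemma nbrs_image:
  assumes "bij f" "\<And>a b. E a b \<longleftrightarrow> E (f a) (f b)"
  shows "nbrs E (f x) = f ` nbrs E x"
proof -
  have "y \<in> f ` nbrs E x" if "y \<in> nbrs E (f x)" for y
  proof -
    obtain z where "y = f z" using bij_is_surj[OF assms(1)] by auto
    with that assms(2)[of x z] show ?thesis by (auto simp: nbrs_def)
  qed
  then show ?thesis using assms(2) by (auto simp: nbrs_def)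
qed

lemma stock_relabel:
  assumes f: "bij f" "\<And>a b. E a b \<longleftrightarrow> E (f a) (f b)" and F: "\<And>y k. F' (f y) k = F y k"
  shows "stock E b (relabel f w) F' (f x) t = stock E b w F x t"
proof -
  have "arrivals b (relabel f w) F' (f y) (f x) t = arrivals b w F y x t" for y
    unfolding arrivals_def ring_relabel[OF f(1)] choice_relabel[OF f(1)] side_map_prod F
    using bij_is_inj[OF f(1)] by (simp add: inj_eq)
  moreover have "departures (relabel f w) F' (f x) t = departures w F x t"
    unfolding departures_def ring_relabel[OF f(1)] F ..
  ultimately show ?thesis
    unfolding stock_def nbrs_image[of f E, OF f] using f(1)
    by (subst sum.reindex) (auto simp: relabel_def bij_is_inj inj_on_subset[OF bij_is_inj])
qed

lemma fires_relabel:
  assumes f: "bij f" "\<And>a b. E a b \<longleftrightarrow> E (f a) (f b)"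
  shows "fires E (relabel f w) (f x) k = fires E w x k"
proof -
  have "approx_fires E (relabel f w) n (f x) k = approx_fires E w n x k" for n x k
    by (induction n arbitrary: x k) (simp_all add: stock_relabel[of f E, OF f] ring_relabel[OF f(1)])
  then show ?thesis by (simp add: fires_def)
qed

text \<open>The increments \<open>\<xi>\<close> are applied in the order of the times
  \<open>r\<close>. Injectivity of \<open>r\<close> means one at a time, so the sum over strictly
  earlier indices is the position just before the increment. The induction removes the latest index,
  which belongs to the past of no other.\<close>

lemma telescope_ordered:
  fixes r :: "'i \<Rightarrow> real" and \<xi> :: "'i \<Rightarrow> int" and g :: "int \<Rightarrow> real"
  assumes "finite R" "inj_on r R"
  shows "g (d + sum \<xi> R) = g d
    + (\<Sum>i\<in>R. g (d + sum \<xi> {j\<in>R. r j < r i} + \<xi> i) - g (d + sum \<xi> {j\<in>R. r j < r i}))"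
  using assms
proof (induction "card R" arbitrary: R)
  case (Suc n)
  then have "R \<noteq> {}" by auto
  have "Max (r ` R) \<in> r ` R" using Suc.prems \<open>R \<noteq> {}\<close> by (intro Max_in) auto
  then obtain m where "m \<in> R" "r m = Max (r ` R)" by auto
  with Suc.prems(1) have m: "m \<in> R" "\<And>i. i \<in> R \<Longrightarrow> r i \<le> r m" by auto
  let ?R = "R - {m}"
  have lt: "r i < r m" if "i \<in> ?R" for i
    using m that Suc.prems(2) by (metis Diff_iff insertCI inj_onD order_le_less)
  have split: "sum h R = sum h ?R + h m" for h :: "'i \<Rightarrow> 'b :: ab_group_add"
    using Suc.prems(1) m(1) by (simp add: sum.remove add.commute)
  have below: "{j\<in>R. r j < r i} = {j\<in>?R. r j < r i}" if "i \<in> R" for i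
    using m(2)[OF that] by auto
  have top: "{j\<in>?R. r j < r m} = ?R" using lt by auto
  have IH: "g (d + sum \<xi> ?R) = g d
    + (\<Sum>i\<in>?R. g (d + sum \<xi> {j\<in>?R. r j < r i} + \<xi> i) - g (d + sum \<xi> {j\<in>?R. r j < r i}))"
    using Suc m(1) by (intro Suc.hyps(1)) (auto intro: inj_on_subset)
  have "(\<Sum>i\<in>R. g (d + sum \<xi> {j\<in>R. r j < r i} + \<xi> i) - g (d + sum \<xi> {j\<in>R. r j < r i}))
     = (\<Sum>i\<in>R. g (d + sum \<xi> {j\<in>?R. r j < r i} + \<xi> i) - g (d + sum \<xi> {j\<in>?R. r j < r i}))"
    using below by (intro sum.cong) auto
  also have "\<dots> = g (d + sum \<xi> ?R) - g d + (g (d + sum \<xi> ?R + \<xi> m) - g (d + sum \<xi> ?R))"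
    unfolding split top IH by simp
  finally show ?case unfolding split[of \<xi>] by (simp add: add.assoc)
qed simp

text \<open>The almost sure properties after which one can argue sample by sample.
  \<open>pos\<close> and \<open>no_ties\<close> make all ring times distinct;
  \<open>fin_rings\<close> keeps every count finite, which matters because \<open>card\<close> of an
  infinite set is 0.\<close>

locale good_sample =
  fixes E :: "'v \<Rightarrow> 'v \<Rightarrow> bool" and w :: "'v sample"
  assumes sym: "\<And>x y. E x y \<Longrightarrow> E y x"
    and fin_nbrs: "\<And>x. finite (nbrs E x)"
    and pos: "\<And>i. 0 < fst (snd w) i"
    and fin_rings: "\<And>x T. finite {k. ring w x k < T}"
    and no_ties: "\<And>x y j k. x \<noteq> y \<Longrightarrow> ring w x j \<noteq> ring w y k"
    and wf: "wf (earlier E (fst (snd w)))"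
    and choice_in: "\<And>x k. choice w x k \<in> nbrs E x \<times> nbrs E x"
begin

section \<open>Existence and uniqueness of the trajectory\<close>

lemma ring_less: "i < j \<Longrightarrow> ring w x i < ring w x j"
proof -
  assume "i < j"
  then have "{..j} = {..i} \<union> {i<..j}" by auto
  moreover have "0 < (\<Sum>k\<in>{i<..j}. fst (snd w) (x, k))"
    using \<open>i < j\<close> pos by (intro sum_pos) auto
  ultimately show ?thesis unfolding ring_def by (subst \<open>{..j} = _\<close>, subst sum.union_disjoint) auto
qed

lemma ring_less_iff: "ring w x i < ring w x j \<longleftrightarrow> i < j"
  using ring_less[of i j x] ring_less[of j i x] by (cases i j rule: linorder_cases) auto

lemma ring_inj: "ring w x j = ring w y k \<longleftrightarrow> x = y \<and> j = k"
  using no_ties[of x y j k] ring_less[of j k x] ring_less[of k j x] by (cases "x = y"; cases j k rule: linorder_cases) auto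

lemma earlier_iff: "((y, j), (x, k)) \<in> earlier E (fst (snd w)) \<longleftrightarrow> (y = x \<or> E x y) \<and> ring w y j < ring w x k"
  by (simp add: earlier_def ring_eq_ring_time)

lemma wf_ring_induct [case_names earlier]:
  assumes "\<And>x k. (\<And>y j. y = x \<or> E x y \<Longrightarrow> ring w y j < ring w x k \<Longrightarrow> P y j) \<Longrightarrow> P x k"
  shows "P x k"
proof -
  have "(\<lambda>(x, k). P x k) (x, k)"
    using wf
  proof (induction rule: wf_induct_rule)
    case (less i)
    obtain x k where i: "i = (x, k)" by (cases i)
    have "P x k"
    proof (rule assms)
      fix y j assume "y = x \<or> E x y" "ring w y j < ring w x k"
      then show "P y j" using less[of "(y, j)"] unfolding i earlier_iff by simp
    qed
    then show ?case unfolding i by simp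
  qed
  then show ?thesis by simp
qed

lemma fin_rings': "finite {k. ring w x k < T \<and> P k}"
  using fin_rings[of x T] by (rule rev_finite_subset) auto

lemma card_arrivals:
  "card {(y, k). ring w y k < t \<and> F y k \<and> side b (choice w y k) = x} = (\<Sum>y\<in>nbrs E x. arrivals b w F y x t)"
proof -
  have "{(y, k). ring w y k < t \<and> F y k \<and> side b (choice w y k) = x}
      = (SIGMA y:nbrs E x. {k. ring w y k < t \<and> F y k \<and> side b (choice w y k) = x})"
  proof (intro equalityI subsetI; clarsimp)
    fix y k
    show "y \<in> nbrs E (side b (choice w y k))"
      using choice_in[of y k] sym by (auto simp: nbrs_def side_def mem_Times_iff)
  qed
  then show ?thesis
    using fin_nbrs fin_rings' by (simp add: card_SigmaI arrivals_def)
qed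

lemma OW_trajectory_iff:
  "OW_trajectory w F \<longleftrightarrow> (\<forall>x k. F x k \<longleftrightarrow> (\<forall>b. 1 \<le> stock E b w F x (ring w x k)))"
proof -
  have "oil_before w F x t = stock E True w F x t" "water_before w F x t = stock E False w F x t" for x t
    using card_arrivals[of t F True x] card_arrivals[of t F False x]
    by (simp_all add: oil_before_def water_before_def stock_def departures_def side_def)
  then show ?thesis by (simp add: OW_trajectory_def all_bool_eq conj_commute)
qed

lemma approx_fires_eventually: "\<exists>N. \<forall>n\<ge>N. approx_fires E w n x k = fires E w x k"
proof (induction x k rule: wf_ring_induct)
  case (earlier x k)
  let ?P = "SIGMA y:insert x (nbrs E x). {j. ring w y j < ring w x k}"
  have "\<forall>i\<in>?P. \<exists>N. \<forall>n\<ge>N. approx_fires E w n (fst i) (snd i) = fires E w (fst i) (snd i)"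
    using earlier by (auto simp: nbrs_def)
  then obtain N where N: "\<And>i n. i \<in> ?P \<Longrightarrow> N i \<le> n \<Longrightarrow> approx_fires E w n (fst i) (snd i) = fires E w (fst i) (snd i)"
    by metis
  have "finite ?P" using fin_nbrs fin_rings by auto
  define M where "M = Max (insert 0 (N ` ?P))"
  have M: "N i \<le> M" if "i \<in> ?P" for i
    unfolding M_def using \<open>finite ?P\<close> that by (intro Max_ge) auto
  have "stock E b w (approx_fires E w n) x (ring w x k) = stock E b w (fires E w) x (ring w x k)" if "M \<le> n" for b n
  proof (rule stock_cong)
    fix y j assume "y = x \<or> E x y"
    then show "ring w y j < ring w x k \<and> approx_fires E w n y j \<longleftrightarrow> ring w y j < ring w x k \<and> fires E w y j"
      using N[of "(y, j)" n] M[of "(y, j)"] that by (auto simp: nbrs_def)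
  qed auto
  \<comment> \<open>Round \<open>n\<close> is computed from the firings of round
    \<open>n - 1\<close>, hence the extra \<open>Suc\<close>.\<close>
  then have st: "approx_fires E w n x k = (\<forall>b. 1 \<le> stock E b w (fires E w) x (ring w x k))" if "Suc M \<le> n" for n
    using that by (cases n) auto
  have "fires E w x k = (\<forall>b. 1 \<le> stock E b w (fires E w) x (ring w x k))"
  proof
    assume "fires E w x k"
    then obtain N where "\<forall>n\<ge>N. approx_fires E w n x k" unfolding fires_def by blast
    then show "\<forall>b. 1 \<le> stock E b w (fires E w) x (ring w x k)"
      using st[of "max N (Suc M)"] by simp
  next
    assume *: "\<forall>b. 1 \<le> stock E b w (fires E w) x (ring w x k)"
    show "fires E w x k"
      unfolding fires_def
    proof (intro exI allI impI)
      fix n assume "Suc M \<le> n"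
      then show "approx_fires E w n x k" using st[of n] * by simp
    qed
  qed
  then have "\<forall>n\<ge>Suc M. approx_fires E w n x k = fires E w x k" using st by simp
  then show ?case by (rule exI)
qed

text \<open>At a level \<open>M\<close> where this ring and the finitely many rings it depends on
  have all stabilized, round \<open>Suc M\<close> computes the outcome from the limiting firings,
  which turns the recursion into a fixed-point equation.\<close>

lemma fires_iff: "fires E w x k \<longleftrightarrow> (\<forall>b. 1 \<le> stock E b w (fires E w) x (ring w x k))"
proof -
  let ?P = "SIGMA y:insert x (nbrs E x). {j. ring w y j < ring w x k}"
  obtain N where N: "\<And>y j n. N y j \<le> n \<Longrightarrow> approx_fires E w n y j = fires E w y j"
    using approx_fires_eventually by metis
  have "finite ?P" using fin_nbrs fin_rings by auto
  define M where "M = Max (insert (N x k) ((\<lambda>(y, j). N y j) ` ?P))"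
  have M: "N y j \<le> M" if "(y, j) \<in> ?P" for y j
    unfolding M_def using \<open>finite ?P\<close> that by (intro Max_ge) (auto intro: rev_image_eqI)
  have "N x k \<le> M" unfolding M_def using \<open>finite ?P\<close> by (intro Max_ge) auto
  have "stock E b w (approx_fires E w M) x (ring w x k) = stock E b w (fires E w) x (ring w x k)" for b
  proof (rule stock_cong)
    fix y j assume "y = x \<or> E x y"
    then show "ring w y j < ring w x k \<and> approx_fires E w M y j \<longleftrightarrow> ring w y j < ring w x k \<and> fires E w y j"
      using N[of y j M] M[of y j] by (auto simp: nbrs_def)
  qed auto
  then show ?thesis using N[of x k "Suc M"] \<open>N x k \<le> M\<close> by simp
qed

text \<open>Existence is the fixed-point equation; uniqueness follows by induction along
  \<open>earlier\<close>, since solutions that agree on all earlier rings have the same stocks. A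
  claim about all trajectories thus becomes one about \<open>fires E w\<close>.\<close>

lemma OW_trajectory_iff_fires: "OW_trajectory w F \<longleftrightarrow> F = fires E w"
proof
  assume F: "OW_trajectory w F"
  have "F x k = fires E w x k" for x k
  proof (induction x k rule: wf_ring_induct)
    case (earlier x k)
    have "stock E b w F x (ring w x k) = stock E b w (fires E w) x (ring w x k)" for b
      by (rule stock_cong) (use earlier in auto)
    then show ?case using F fires_iff[of x k] unfolding OW_trajectory_iff by simp
  qed
  then show "F = fires E w" by blast
qed (use fires_iff OW_trajectory_iff in blast)

text \<open>At the last firing of \<open>x\<close> before \<open>t\<close> both stocks were at least
  1; that firing takes one away, and afterwards there are only arrivals.\<close>

lemma stock_nonneg: "0 \<le> stock E b w (fires E w) x t"
proof (cases "{k. ring w x k < t \<and> fires E w x k} = {}")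
  case True
  then have "departures w (fires E w) x t = 0" unfolding departures_def by (simp only: card.empty)
  then show ?thesis unfolding stock_def by (simp add: sum_nonneg)
next
  case False
  let ?D = "{k. ring w x k < t \<and> fires E w x k}"
  have fin: "finite ?D" by (rule fin_rings')
  define k where "k = Max ?D"
  have k: "k \<in> ?D" "\<And>j. j \<in> ?D \<Longrightarrow> j \<le> k" using fin False unfolding k_def by (auto intro: Max_in simp del: mem_Collect_eq)
  have "?D = insert k {j. ring w x j < ring w x k \<and> fires E w x j}"
    using k by (auto simp: ring_less_iff le_less intro: order.strict_trans[of _ "ring w x k"])
  then have "departures w (fires E w) x t = Suc (departures w (fires E w) x (ring w x k))"
    unfolding departures_def by (simp add: fin_rings')
  moreover have "arrivals b w (fires E w) y x (ring w x k) \<le> arrivals b w (fires E w) y x t" for y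
    unfolding arrivals_def using k(1) by (intro card_mono fin_rings') auto
  then have "(\<Sum>y\<in>nbrs E x. int (arrivals b w (fires E w) y x (ring w x k))) \<le> (\<Sum>y\<in>nbrs E x. int (arrivals b w (fires E w) y x t))"
    by (intro sum_mono) simp
  moreover have "1 \<le> stock E b w (fires E w) x (ring w x k)"
    using k(1) fires_iff[of x k] by simp
  ultimately show ?thesis unfolding stock_def by simp
qed

lemma fixates_fires:
  assumes "\<And>x. finite {k. fires E w x k}"
  shows "fixates w (fires E w)"
  unfolding fixates_def
proof safe
  fix A :: "'v set" assume A: "finite A"
  let ?T = "insert 0 (\<Union>x\<in>A. ring w x ` {k. fires E w x k})"
  have T: "finite ?T" using A assms by auto
  show "\<exists>\<tau>\<ge>0. \<forall>x\<in>A. \<forall>t>\<tau>. firings w (fires E w) t x = firings w (fires E w) \<tau> x"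
  proof (intro exI conjI ballI allI impI)
    show "0 \<le> Max ?T" using T by (intro Max_ge) auto
    fix x t assume x: "x \<in> A" and t: "Max ?T < t"
    have "ring w x k \<le> Max ?T" if "fires E w x k" for k
      using T x that by (intro Max_ge) auto
    with t have "{k. ring w x k \<le> t \<and> fires E w x k} = {k. ring w x k \<le> Max ?T \<and> fires E w x k}"
      by fastforce
    then show "firings w (fires E w) t x = firings w (fires E w) (Max ?T) x"
      by (simp add: firings_def)
  qed
qed

section \<open>The gap as a walk driven by the firings of neighbours\<close>

definition nbr_firings :: "'v \<Rightarrow> real \<Rightarrow> ('v \<times> nat) set" where
  "nbr_firings x t = (SIGMA y:nbrs E x. {k. ring w y k < t \<and> fires E w y k})"

definition kick :: "'v \<Rightarrow> 'v \<times> nat \<Rightarrow> int" where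
  "kick x i = of_bool (fst (choice w (fst i) (snd i)) = x) - of_bool (snd (choice w (fst i) (snd i)) = x)"

lemma finite_nbr_firings: "finite (nbr_firings x t)"
  unfolding nbr_firings_def using fin_nbrs fin_rings' by auto

lemma gap_eq: "gap E w x t = int (fst (fst w x)) - int (snd (fst w x)) + sum (kick x) (nbr_firings x t)"
proof -
  have a: "int (arrivals b w (fires E w) y x t)
      = (\<Sum>k | ring w y k < t \<and> fires E w y k. of_bool (side b (choice w y k) = x))" for b y
    using fin_rings' by (simp add: arrivals_def sum.If_cases of_bool_def Int_def conj_assoc)
  have "(\<Sum>y\<in>nbrs E x. int (arrivals True w (fires E w) y x t)) - (\<Sum>y\<in>nbrs E x. int (arrivals False w (fires E w) y x t))
      = sum (kick x) (nbr_firings x t)"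
    unfolding a nbr_firings_def sum_subtractf[symmetric] using fin_nbrs fin_rings'
    by (subst sum.Sigma) (simp_all add: kick_def side_def case_prod_unfold)
  then show ?thesis unfolding gap_def stock_def side_def by simp
qed

lemma nbr_firings_before:
  assumes "i \<in> nbr_firings x t"
  shows "{j \<in> nbr_firings x t. ring w (fst j) (snd j) < ring w (fst i) (snd i)} = nbr_firings x (ring w (fst i) (snd i))"
  using assms unfolding nbr_firings_def by auto

text \<open>A discrete Tanaka formula: after averaging over the kicks, the increments of the
  distance to \<open>a\<close> vanish except at firings that see the gap equal to \<open>a\<close>,
  so the sum becomes a local time at \<open>a\<close>.\<close>

lemma abs_gap_telescope:
  "\<bar>real_of_int (gap E w x t - a)\<bar> = \<bar>real_of_int (int (fst (fst w x)) - int (snd (fst w x)) - a)\<bar>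
    + (\<Sum>i\<in>nbr_firings x t. \<bar>real_of_int (gap E w x (ring w (fst i) (snd i)) + kick x i - a)\<bar>
        - \<bar>real_of_int (gap E w x (ring w (fst i) (snd i)) - a)\<bar>)"
proof -
  let ?r = "\<lambda>i. ring w (fst i) (snd i)"
  let ?g = "\<lambda>d :: int. \<bar>real_of_int (d - a)\<bar>"
  have "inj_on ?r (nbr_firings x t)"
    by (auto simp: inj_on_def ring_inj)
  from telescope_ordered[OF finite_nbr_firings this, of ?g "int (fst (fst w x)) - int (snd (fst w x))" "kick x"]
  show ?thesis unfolding gap_eq by (simp add: nbr_firings_before cong: sum.cong)
qed

text \<open>Choose \<open>n\<close> beyond the finitely many firings in \<open>?B\<close> with gap
  at most \<open>K\<close> in absolute value at time \<open>n\<close>. The first firing of any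
  neighbour from time \<open>n\<close> on still sees this gap, so it belongs to \<open>?B\<close>
  although it is too late.\<close>

lemma finite_nbr_fires:
  assumes fin: "\<And>a y. y \<in> nbrs E x \<Longrightarrow> finite {k. fires E w y k \<and> gap E w x (ring w y k) = a}"
    and K: "\<exists>\<^sub>\<infinity>n. \<bar>gap E w x (real n)\<bar> \<le> K"
    and y: "y \<in> nbrs E x"
  shows "finite {k. fires E w y k}"
proof (rule ccontr)
  assume inf: "infinite {k. fires E w y k}"
  let ?r = "\<lambda>i. ring w (fst i) (snd i)"
  let ?B = "SIGMA y:nbrs E x. \<Union>a\<in>{-K..K}. {k. fires E w y k \<and> gap E w x (ring w y k) = a}"
  have B: "finite ?B" using fin fin_nbrs by (intro finite_SigmaI) auto
  define T where "T = Max (insert 0 (?r ` ?B))"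
  have T: "?r i \<le> T" if "i \<in> ?B" for i
    unfolding T_def using B that by (intro Max_ge) auto
  obtain N where "T < real N" using reals_Archimedean2 by blast
  obtain n where n: "N < n" "\<bar>gap E w x (real n)\<bar> \<le> K"
    using K unfolding INFM_nat by blast
  have "\<not> {k. fires E w y k} \<subseteq> {k. ring w y k < real n}"
    using inf fin_rings finite_subset by blast
  then obtain k0 where k0: "fires E w y k0" "real n \<le> ring w y k0"
    unfolding subset_iff mem_Collect_eq not_all not_imp not_less by blast
  \<comment> \<open>Cutting off at \<open>ring w y k0 + 1\<close> keeps the set finite while
    retaining the firing \<open>k0\<close>, so a first firing exists.\<close>
  let ?I = "{i \<in> nbr_firings x (ring w y k0 + 1). real n \<le> ?r i}"
  have I: "finite ?I" "(y, k0) \<in> ?I"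
    using finite_nbr_firings k0 y by (auto simp: nbr_firings_def)
  have "Min (?r ` ?I) \<in> ?r ` ?I" using I by (intro Min_in) auto
  then obtain i where "i \<in> ?I" "?r i = Min (?r ` ?I)" by auto
  with I(1) have i: "i \<in> ?I" "\<And>j. j \<in> ?I \<Longrightarrow> ?r i \<le> ?r j" by auto
  have "nbr_firings x (?r i) = nbr_firings x (real n)"
  proof (intro equalityI subsetI)
    fix j assume j: "j \<in> nbr_firings x (?r i)"
    show "j \<in> nbr_firings x (real n)"
    proof (rule ccontr)
      assume "j \<notin> nbr_firings x (real n)"
      with j i(1) have "j \<in> ?I" by (auto simp: nbr_firings_def not_less)
      from i(2)[OF this] j show False by (auto simp: nbr_firings_def)
    qed
  next
    fix j assume "j \<in> nbr_firings x (real n)"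
    then show "j \<in> nbr_firings x (?r i)" using i(1) by (auto simp: nbr_firings_def)
  qed
  then have "gap E w x (?r i) = gap E w x (real n)" by (simp add: gap_eq)
  with n(2) i(1) have "i \<in> ?B" by (auto simp: nbr_firings_def abs_le_iff)
  from T[OF this] i(1) n(1) \<open>T < real N\<close> show False by simp
qed

end

section \<open>The probability space\<close>

lemma distr_pair_snd:
  assumes "prob_space M" "prob_space N"
  shows "distr (M \<Otimes>\<^sub>M N) N snd = N"
proof (rule measure_eqI)
  interpret M: prob_space M by fact
  interpret N: prob_space N by fact
  fix A assume "A \<in> sets (distr (M \<Otimes>\<^sub>M N) N snd)"
  then have A: "A \<in> sets N" by simp
  have "snd -` A \<inter> space (M \<Otimes>\<^sub>M N) = space M \<times> A"
    using sets.sets_into_space[OF A] by (auto simp: space_pair_measure)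
  then show "emeasure (distr (M \<Otimes>\<^sub>M N) N snd) A = emeasure N A"
    using A by (simp add: emeasure_distr N.emeasure_pair_measure_Times M.emeasure_space_1)
qed simp

lemma distr_measure_pmf: "distr (measure_pmf p) (measure_pmf q) g = measure_pmf (map_pmf g p)"
  unfolding map_pmf_rep_eq by (rule distr_cong) auto

definition set_choice :: "'v sample \<Rightarrow> 'v \<times> nat \<Rightarrow> 'v \<times> 'v \<Rightarrow> 'v sample" where
  "set_choice w i c = (fst w, fst (snd w), (snd (snd w))(i := c))"

lemma choice_set_choice: "choice (set_choice w (y, k) c) z j = (if z = y \<and> j = k then c else choice w z j)"
  by (auto simp: choice_def set_choice_def)

lemma ring_set_choice [simp]: "ring (set_choice w i c) y k = ring w y k"
  by (simp add: ring_def set_choice_def)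

lemma fires_set_choice [simp]: "fires E (set_choice w (y, k) c) y k = fires E w y k"
  by (rule fires_local[symmetric, where T="ring w y k"]) (auto simp: set_choice_def choice_def)

lemma gap_set_choice [simp]: "gap E (set_choice w (y, k) c) x (ring w y k) = gap E w x (ring w y k)"
  by (rule gap_local[symmetric]) (auto simp: set_choice_def choice_def)

locale ow_graph =
  fixes E :: "'v \<Rightarrow> 'v \<Rightarrow> bool" and \<nu> :: "nat pmf"
  assumes simple: "simple_graph E"
    and connected: "connected_graph E"
    and infinite: "infinite (UNIV :: 'v set)"
    and finite_deg: "finite_degree E"
    and transitive: "vertex_transitive E"
begin

lemma sym: "E x y \<Longrightarrow> E y x"
  using simple by (auto simp: simple_graph_def)

lemma finite_nbrs: "finite (nbrs E x)"
  using finite_deg by (simp add: finite_degree_def)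

definition deg :: nat where
  "deg = card (nbrs E undefined)"

lemma card_nbrs: "card (nbrs E x) = deg"
proof -
  obtain f where f: "bij f" "\<And>a b. E a b \<longleftrightarrow> E (f a) (f b)" "f x = undefined"
    using transitive unfolding vertex_transitive_def by blast
  have "deg = card (f ` nbrs E x)" unfolding deg_def f(3)[symmetric] nbrs_image[of f E, OF f(1,2)] ..
  then show ?thesis using f(1) by (simp add: card_image bij_is_inj inj_on_subset[OF bij_is_inj])
qed

text \<open>In degree at most 1 a component has at most two vertices. A second neighbour is
  essential: with only one, oil and water would always jump together and no gap would ever
  move.\<close>

lemma deg_ge_2: "2 \<le> deg"
proof (rule ccontr)
  assume "\<not> 2 \<le> deg"
  then have le: "card (nbrs E x) \<le> 1" for x using card_nbrs by simp
  fix x :: 'v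
  have closed: "z \<in> insert x (nbrs E x)" if "E\<^sup>*\<^sup>* x z" for z
    using that
  proof (induction rule: rtranclp_induct)
    case (step y z)
    then consider "y = x" | "E x y" by (auto simp: nbrs_def)
    then show ?case
    proof cases
      case 2
      then have "x \<in> nbrs E y" "z \<in> nbrs E y" using step sym by (auto simp: nbrs_def)
      then have "z = x" using le[of y] finite_nbrs[of y] card_le_Suc0_iff_eq by (metis One_nat_def)
      then show ?thesis by simp
    qed (use step in \<open>auto simp: nbrs_def\<close>)
  qed simp
  then have "UNIV \<subseteq> insert x (nbrs E x)" using connected by (auto simp: connected_graph_def)
  then show False using infinite finite_nbrs[of x] finite_subset by blast
qed

lemma nbrs_nonempty: "nbrs E x \<noteq> {}"
  using card_nbrs[of x] deg_ge_2 by auto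

lemma countable_UNIV: "countable (UNIV :: 'v set)"
proof -
  fix x :: 'v
  have "UNIV = (\<Union>n. {y. (E ^^ n) x y})"
    using connected by (auto simp: connected_graph_def rtranclp_power)
  moreover have "finite {y. (E ^^ n) x y}" for n
    using finite_nbrs by (intro finite_relpowp_ball) (simp add: nbrs_def)
  ultimately show ?thesis by (metis countable_UN countable_finite countableI_type)
qed

definition step_pmf :: "'v \<Rightarrow> ('v \<times> 'v) pmf" where
  "step_pmf x = pair_pmf (pmf_of_set (nbrs E x)) (pmf_of_set (nbrs E x))"

lemma choice_measure_eq: "choice_measure E = (\<Pi>\<^sub>M i\<in>UNIV. measure_pmf (step_pmf (fst i)))"
  by (simp add: choice_measure_def step_pmf_def)

lemma set_step_pmf: "set_pmf (step_pmf x) = nbrs E x \<times> nbrs E x"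
  using finite_nbrs nbrs_nonempty by (simp add: step_pmf_def)

sublocale init: prob_space "init_measure \<nu> :: ('v \<Rightarrow> nat \<times> nat) measure"
  unfolding init_measure_def by (intro prob_space_PiM prob_space_measure_pmf)

sublocale ch: prob_space "choice_measure E"
  unfolding choice_measure_def by (intro prob_space_PiM prob_space_measure_pmf)

sublocale cc: prob_space "(clock_measure :: ('v \<times> nat \<Rightarrow> real) measure) \<Otimes>\<^sub>M choice_measure E"
  by (intro prob_space_pair clock.prob_space_axioms ch.prob_space_axioms)

abbreviation P :: "'v sample measure" where "P \<equiv> OW_prob E \<nu>"

sublocale prob_space P
  unfolding OW_prob_def by (intro prob_space_pair init.prob_space_axioms cc.prob_space_axioms)

lemma space_P [simp]: "space P = UNIV"
  by (simp add: OW_prob_def space_pair_measure init_measure_def choice_measure_def space_PiM)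

lemma distr_clock: "distr P clock_measure (\<lambda>w. fst (snd w)) = clock_measure"
proof -
  have "distr P clock_measure (\<lambda>w. fst (snd w))
      = distr (distr P (clock_measure \<Otimes>\<^sub>M choice_measure E) snd) clock_measure fst"
    unfolding OW_prob_def by (subst distr_distr) (auto simp: comp_def)
  also have "distr P (clock_measure \<Otimes>\<^sub>M choice_measure E) snd = clock_measure \<Otimes>\<^sub>M choice_measure E"
    unfolding OW_prob_def by (intro distr_pair_snd init.prob_space_axioms cc.prob_space_axioms)
  finally show ?thesis by (simp add: ch.distr_pair_fst)
qed

lemma distr_choice: "distr P (choice_measure E) (\<lambda>w. snd (snd w)) = choice_measure E"
proof -
  have "distr P (choice_measure E) (\<lambda>w. snd (snd w))
      = distr (distr P (clock_measure \<Otimes>\<^sub>M choice_measure E) snd) (choice_measure E) snd"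
    unfolding OW_prob_def by (subst distr_distr) (auto simp: comp_def)
  also have "distr P (clock_measure \<Otimes>\<^sub>M choice_measure E) snd = clock_measure \<Otimes>\<^sub>M choice_measure E"
    unfolding OW_prob_def by (intro distr_pair_snd init.prob_space_axioms cc.prob_space_axioms)
  finally show ?thesis by (simp add: distr_pair_snd clock.prob_space_axioms ch.prob_space_axioms)
qed

lemma distr_init: "distr P (init_measure \<nu>) fst = init_measure \<nu>"
  unfolding OW_prob_def by (rule cc.distr_pair_fst)

section \<open>Measurability of the dynamics\<close>

lemma measurable_fst_P [measurable]: "fst \<in> measurable P (init_measure \<nu>)"
  and measurable_clock_P [measurable]: "(\<lambda>w. fst (snd w)) \<in> measurable P clock_measure"
  and measurable_choice_P [measurable]: "(\<lambda>w. snd (snd w)) \<in> measurable P (choice_measure E)"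
  unfolding OW_prob_def by measurable

lemma measurable_ring [measurable]: "(\<lambda>w. ring w x k) \<in> borel_measurable P"
  unfolding ring_eq_ring_time by (rule measurable_compose[OF measurable_clock_P ring_time_measurable])

lemma measurable_init [measurable]: "(\<lambda>w. fst w x) \<in> measurable P (count_space UNIV)"
proof -
  have "(\<lambda>X. X x) \<in> measurable (init_measure \<nu>) (measure_pmf (pair_pmf \<nu> \<nu>))"
    unfolding init_measure_def by (rule measurable_component_singleton) simp
  from measurable_compose[OF measurable_fst_P this] show ?thesis by simp
qed

lemma measurable_choice [measurable]: "(\<lambda>w. choice w x k) \<in> measurable P (count_space UNIV)"
proof -
  have "(\<lambda>X. X (x, k)) \<in> measurable (choice_measure E) (measure_pmf (step_pmf (fst (x, k))))"
    unfolding choice_measure_eq by (rule measurable_component_singleton) simp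
  from measurable_compose[OF measurable_choice_P this] show ?thesis by (simp add: choice_def)
qed

lemma measurable_stock:
  assumes [measurable]: "\<And>y k. Measurable.pred P (\<lambda>w. F w y k)" "t \<in> borel_measurable P"
  shows "(\<lambda>w. real_of_int (stock E b w (F w) x (t w))) \<in> borel_measurable P"
proof -
  have c: "(\<lambda>w. real (card (S w))) \<in> borel_measurable P"
    if "\<And>k :: nat. Measurable.pred P (\<lambda>w. k \<in> S w)" for S
  proof -
    have "(\<lambda>w. card (S w)) \<in> measurable P (count_space UNIV)"
      using that by (intro measurable_card) (simp only: pred_def)
    then show ?thesis by (rule measurable_compose) simp
  qed
  have [measurable]: "(\<lambda>w. real (departures w (F w) x (t w))) \<in> borel_measurable P"
    unfolding departures_def by (rule c) simp
  have [measurable]: "Measurable.pred P (\<lambda>w. side b (choice w y k) = x)" for y k x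
    using measurable_choice by (rule measurable_compose) simp
  have [measurable]: "(\<lambda>w. real (arrivals b w (F w) y x (t w))) \<in> borel_measurable P" for y
    unfolding arrivals_def by (rule c) simp
  have [measurable]: "(\<lambda>w. real (side b (fst w x))) \<in> borel_measurable P"
    using measurable_init by (rule measurable_compose) simp
  show ?thesis unfolding stock_def by simp
qed

lemma measurable_approx_fires [measurable]: "Measurable.pred P (\<lambda>w. approx_fires E w n x k)"
proof (induction n arbitrary: x k)
  case (Suc n)
  have "(\<lambda>w. real_of_int (stock E b w (approx_fires E w n) x (ring w x k))) \<in> borel_measurable P" for b
    by (rule measurable_stock) (use Suc in auto)
  then have "Measurable.pred P (\<lambda>w. 1 \<le> real_of_int (stock E b w (approx_fires E w n) x (ring w x k)))" for b
    by measurable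
  then show ?case by simp
qed simp

lemma measurable_fires [measurable]: "Measurable.pred P (\<lambda>w. fires E w x k)"
  unfolding fires_def by measurable

lemma measurable_gap:
  assumes "t \<in> borel_measurable P"
  shows "(\<lambda>w. real_of_int (gap E w x (t w))) \<in> borel_measurable P"
  unfolding gap_def of_int_diff
  by (intro borel_measurable_diff measurable_stock measurable_fires assms)

lemma AE_good_sample: "AE w in P. good_sample E w"
proof -
  \<comment> \<open>Any positive window length below \<open>1 / deg\<close> gives a subcritical
    percolation of ringing vertices.\<close>
  define e where "e = 1 / (real deg + 1)"
  have e: "0 < e" "real deg * e < 1" unfolding e_def by (auto simp: field_simps)
  have lift: "AE w in P. Q (fst (snd w))" if "AE S in clock_measure. Q S" for Q
    using that by (intro AE_distrD[OF measurable_clock_P]) (simp only: distr_clock)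
  have "AE w in P. \<forall>i\<in>UNIV. snd (snd w) i \<in> nbrs E (fst i) \<times> nbrs E (fst i)"
  proof (subst AE_ball_countable, safe)
    show "countable (UNIV :: ('v \<times> nat) set)" using countable_UNIV by (simp flip: UNIV_Times_UNIV)
  next
    fix x :: 'v and k :: nat
    have "AE X in choice_measure E. X (x, k) \<in> nbrs E (fst (x, k)) \<times> nbrs E (fst (x, k))"
      unfolding choice_measure_eq
      by (intro AE_PiM_component prob_space_measure_pmf) (simp_all add: AE_measure_pmf_iff set_step_pmf)
    then show "AE w in P. snd (snd w) (x, k) \<in> nbrs E (fst (x, k)) \<times> nbrs E (fst (x, k))"
      by (intro AE_distrD[OF measurable_choice_P]) (simp only: distr_choice)
  qed
  moreover note lift[OF AE_clock_pos[OF countable_UNIV]] lift[OF AE_clock_finite_rings[OF countable_UNIV]]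
    lift[OF AE_clock_no_ties[OF countable_UNIV]] lift[OF AE_clock_windows[OF countable_UNIV finite_deg card_nbrs e]]
  ultimately show ?thesis
  proof eventually_elim
    fix w :: "'v sample"
    let ?S = "fst (snd w)"
    assume w: "\<forall>i\<in>UNIV. snd (snd w) i \<in> nbrs E (fst i) \<times> nbrs E (fst i)"
      "\<forall>i. 0 < ?S i" "\<forall>x T. finite {k. ring_time ?S x k < T}"
      "\<forall>x y j k. x \<noteq> y \<longrightarrow> ring_time ?S x j \<noteq> ring_time ?S y k"
      "\<forall>x (j :: nat). finite {y. (\<lambda>a b. E a b \<and> (\<exists>k. ring_time ?S b k \<in> {real j * e..<(real j + 1) * e}))\<^sup>*\<^sup>* x y}"
    have "wf (earlier E ?S)"
    proof (rule wf_earlier)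
      show "0 \<le> ring_time ?S x k" for x k
        unfolding ring_time_def using w(2) by (intro sum_nonneg) (simp add: less_imp_le)
      show "finite {k. ring_time ?S x k < T}" for x T using w(3) by blast
      show "finite {y. (\<lambda>a b. E a b \<and> (\<exists>k. ring_time ?S b k \<in> {real j * e..<(real j + 1) * e}))\<^sup>*\<^sup>* x y}"
        for x and j :: nat using w(5) by blast
    qed (rule e(1))
    moreover have "choice w x k \<in> nbrs E x \<times> nbrs E x" for x k
      using w(1) by (auto simp: choice_def dest!: bspec[of _ _ "(x, k)"])
    ultimately show "good_sample E w"
      using w(2-4) sym finite_nbrs by unfold_locales (auto simp: ring_eq_ring_time)
  qed
qed

section \<open>Automorphism invariance and resampling of one choice\<close>

lemma relabel_invariant:
  assumes f: "bij f" "\<And>a b. E a b \<longleftrightarrow> E (f a) (f b)"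
  shows "relabel f \<in> measurable P P" "distr P P (relabel f) = P"
proof -
  let ?A = "\<lambda>\<eta> :: 'v \<Rightarrow> nat \<times> nat. \<lambda>x. \<eta> (inv f x)"
  let ?p = "\<lambda>i :: 'v \<times> nat. (inv f (fst i), snd i)"
  let ?B = "\<lambda>S :: 'v \<times> nat \<Rightarrow> real. \<lambda>i. S (?p i)"
  let ?C = "\<lambda>X :: 'v \<times> nat \<Rightarrow> 'v \<times> 'v. \<lambda>i. map_prod f f (X (?p i))"
  have bi: "bij (inv f)" using f(1) by (rule bij_imp_bij_inv)
  have bp: "bij ?p"
    using f(1) by (intro o_bij[of "\<lambda>i. (f (fst i), snd i)"]) (auto simp: fun_eq_iff bij_is_surj surj_f_inv_f bij_is_inj)
  have mA: "?A \<in> measurable (init_measure \<nu>) (init_measure \<nu>)"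
    unfolding init_measure_def by (rule measurable_PiM_single') (auto simp: space_PiM)
  have mB: "?B \<in> measurable clock_measure clock_measure"
    unfolding clock_measure_def by (rule measurable_PiM_single') (auto simp: space_PiM)
  have mC: "?C \<in> measurable (choice_measure E) (choice_measure E)"
    unfolding choice_measure_def
    by (rule measurable_PiM_single') (auto simp: space_PiM intro!: measurable_compose[OF measurable_component_singleton])
  have A: "distr (init_measure \<nu>) (init_measure \<nu>) ?A = init_measure \<nu>"
    unfolding init_measure_def
    by (rule distr_PiM_relabel[where g="\<lambda>_ x. x"]) (auto simp: prob_space_measure_pmf bi)
  have B: "distr clock_measure clock_measure ?B = clock_measure"
    unfolding clock_measure_def
    by (rule distr_PiM_relabel[where g="\<lambda>_ x. x"]) (auto simp: prob_space_exponential_density bp)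
  have C: "distr (choice_measure E) (choice_measure E) ?C = choice_measure E"
    unfolding choice_measure_eq
  proof (rule distr_PiM_relabel[where g="\<lambda>_. map_prod f f"])
    fix i :: "'v \<times> nat"
    \<comment> \<open>An automorphism maps the neighbours of \<open>inv f (fst i)\<close>
      bijectively onto those of \<open>fst i\<close>, so uniform laws go to uniform laws.\<close>
    have "map_pmf (map_prod f f) (step_pmf (inv f (fst i))) = step_pmf (fst i)"
      using nbrs_image[of f E "inv f (fst i)", OF f] f(1) finite_nbrs nbrs_nonempty
      by (simp add: step_pmf_def map_prod_def map_pair map_pmf_of_set_inj bij_is_surj surj_f_inv_f inj_on_subset[OF bij_is_inj])
    then show "distr (measure_pmf (step_pmf (fst (?p i)))) (measure_pmf (step_pmf (fst i))) (map_prod f f)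
        = measure_pmf (step_pmf (fst i))"
      by (simp add: distr_measure_pmf)
  qed (auto simp: prob_space_measure_pmf bp)
  have eq: "relabel f = (\<lambda>(\<eta>, z). (?A \<eta>, (\<lambda>(S, X). (?B S, ?C X)) z))"
    by (auto simp: relabel_def fun_eq_iff)
  have mBC: "(\<lambda>(S, X). (?B S, ?C X)) \<in> measurable (clock_measure \<Otimes>\<^sub>M choice_measure E) (clock_measure \<Otimes>\<^sub>M choice_measure E)"
    using mB mC by measurable
  show "relabel f \<in> measurable P P"
    unfolding eq OW_prob_def using mA mBC by measurable
  have "distr (clock_measure \<Otimes>\<^sub>M choice_measure E) (clock_measure \<Otimes>\<^sub>M choice_measure E) (\<lambda>(S, X). (?B S, ?C X))
      = clock_measure \<Otimes>\<^sub>M choice_measure E"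
    using pair_measure_distr[OF mB mC] by (simp add: B C ch.sigma_finite_measure_axioms)
  then show "distr P P (relabel f) = P"
    unfolding eq OW_prob_def using pair_measure_distr[OF mA mBC]
    by (simp add: A cc.sigma_finite_measure_axioms)
qed

lemma measurable_set_choice: "(\<lambda>(w, c). set_choice w i c) \<in> measurable (P \<Otimes>\<^sub>M measure_pmf (step_pmf (fst i))) P"
proof -
  have "(\<lambda>(X, c). X(i := c)) \<in> measurable (choice_measure E \<Otimes>\<^sub>M measure_pmf (step_pmf (fst i))) (choice_measure E)"
    using measurable_add_dim[of i UNIV "\<lambda>i. measure_pmf (step_pmf (fst i))"] unfolding choice_measure_eq by simp
  then have [measurable]: "(\<lambda>z. (fst z)(i := snd z)) \<in> measurable (choice_measure E \<Otimes>\<^sub>M measure_pmf (step_pmf (fst i))) (choice_measure E)"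
    by (simp add: case_prod_unfold)
  have [measurable]: "(\<lambda>z. (snd (snd (fst z)))(i := snd z)) \<in> measurable (P \<Otimes>\<^sub>M measure_pmf (step_pmf (fst i))) (choice_measure E)"
    by (rule measurable_compose[where g="\<lambda>z. (fst z)(i := snd z)" and f="\<lambda>z. (snd (snd (fst z)), snd z)", simplified])
      measurable
  show ?thesis
    unfolding set_choice_def case_prod_unfold
    by (subst (2) OW_prob_def) measurable
qed

text \<open>This takes the place of conditioning on the past of ring \<open>i\<close>: in the
  applications the other factors of \<open>f\<close> do not change under \<open>set_choice\<close>,
  so the inner integral is an average over a single jump.\<close>

lemma nn_integral_set_choice:
  assumes f: "f \<in> borel_measurable P"
  shows "(\<integral>\<^sup>+w. f w \<partial>P) = (\<integral>\<^sup>+w. (\<integral>\<^sup>+c. f (set_choice w i c) \<partial>measure_pmf (step_pmf (fst i))) \<partial>P)"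
proof -
  have split: "(\<integral>\<^sup>+w. g w \<partial>P) = (\<integral>\<^sup>+\<eta>. \<integral>\<^sup>+S. \<integral>\<^sup>+X. g (\<eta>, S, X) \<partial>choice_measure E \<partial>clock_measure \<partial>init_measure \<nu>)"
    if "g \<in> borel_measurable P" for g
  proof -
    have g [measurable]: "g \<in> borel_measurable (init_measure \<nu> \<Otimes>\<^sub>M (clock_measure \<Otimes>\<^sub>M choice_measure E))"
      using that by (simp add: OW_prob_def)
    have "(\<integral>\<^sup>+w. g w \<partial>P) = (\<integral>\<^sup>+\<eta>. \<integral>\<^sup>+z. g (\<eta>, z) \<partial>(clock_measure \<Otimes>\<^sub>M choice_measure E) \<partial>init_measure \<nu>)"
      unfolding OW_prob_def by (rule cc.nn_integral_fst[symmetric, OF g])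
    also have "\<dots> = (\<integral>\<^sup>+\<eta>. \<integral>\<^sup>+S. \<integral>\<^sup>+X. g (\<eta>, S, X) \<partial>choice_measure E \<partial>clock_measure \<partial>init_measure \<nu>)"
      by (intro nn_integral_cong ch.nn_integral_fst[symmetric]) measurable
    finally show ?thesis .
  qed
  have m: "(\<lambda>w. \<integral>\<^sup>+c. f (set_choice w i c) \<partial>measure_pmf (step_pmf (fst i))) \<in> borel_measurable P"
    using measurable_compose[OF measurable_set_choice f]
    by (intro measure_pmf.borel_measurable_nn_integral) (simp add: case_prod_unfold)
  have f' [measurable]: "f \<in> borel_measurable (init_measure \<nu> \<Otimes>\<^sub>M (clock_measure \<Otimes>\<^sub>M choice_measure E))"
    using f by (simp add: OW_prob_def)
  have "(\<integral>\<^sup>+X. f (\<eta>, S, X) \<partial>choice_measure E)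
      = (\<integral>\<^sup>+X. (\<integral>\<^sup>+c. f (\<eta>, S, X(i := c)) \<partial>measure_pmf (step_pmf (fst i))) \<partial>choice_measure E)"
    if "\<eta> \<in> space (init_measure \<nu>)" "S \<in> space clock_measure" for \<eta> S
  proof -
    have "(\<lambda>X. f (\<eta>, S, X)) \<in> borel_measurable (choice_measure E)"
      using that by measurable
    then show ?thesis unfolding choice_measure_eq
      by (intro nn_integral_PiM_resample prob_space_measure_pmf)
  qed
  then show ?thesis
    unfolding split[OF f] split[OF m] by (simp add: set_choice_def cong: nn_integral_cong)
qed

end

section \<open>Expectations and fixation\<close>

lemma suminf_indicator_mult:
  fixes g :: "nat \<Rightarrow> ennreal"
  assumes "finite A"
  shows "(\<Sum>k. indicator A k * g k) = sum g A"
proof -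
  have "(\<Sum>k. indicator A k * g k) = (\<Sum>k\<in>A. indicator A k * g k)"
    using assms by (intro suminf_finite) auto
  also have "\<dots> = sum g A" by (intro sum.cong) auto
  finally show ?thesis .
qed

lemma suminf_indicator:
  assumes "finite A"
  shows "(\<Sum>k. indicator A k :: ennreal) = of_nat (card A)"
  using suminf_indicator_mult[OF assms, of "\<lambda>_. 1"] by simp

text \<open>A step of size at most 1 from a nonzero integer cannot cross 0, so the absolute value
  acts linearly and the mean-zero step contributes nothing; from 0 the gain is the mean of
  \<bar>\<xi>\<bar>. The added 1 keeps the integrand nonnegative.\<close>

lemma nn_integral_abs_step:
  fixes q :: "'c pmf" and \<xi> :: "'c \<Rightarrow> int" and \<delta> :: int
  assumes bd: "\<And>c. \<bar>\<xi> c\<bar> \<le> 1" and mean: "measure_pmf.expectation q (\<lambda>c. real_of_int (\<xi> c)) = 0"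
  shows "(\<integral>\<^sup>+c. ennreal (1 + (\<bar>real_of_int (\<delta> + \<xi> c)\<bar> - \<bar>real_of_int \<delta>\<bar>)) \<partial>q)
    = 1 + ennreal (measure_pmf.expectation q (\<lambda>c. \<bar>real_of_int (\<xi> c)\<bar>)) * of_bool (\<delta> = 0)"
proof -
  have bd': "\<bar>real_of_int (\<xi> c)\<bar> \<le> 1" for c using bd[of c] by linarith
  have int: "integrable q (\<lambda>c. real_of_int (\<xi> c))" "integrable q (\<lambda>c. \<bar>real_of_int (\<xi> c)\<bar>)"
    using bd' by (auto intro!: measure_pmf.integrable_const_bound[where B=1])
  have nn: "0 \<le> measure_pmf.expectation q (\<lambda>c. \<bar>real_of_int (\<xi> c)\<bar>)"
    by (intro integral_nonneg_AE) auto
  \<comment> \<open>Here \<open>s\<close> stands for the sign of \<delta> in the two nonzero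
    cases.\<close>
  have "(\<integral>\<^sup>+c. ennreal (1 + s * real_of_int (\<xi> c)) \<partial>q) = 1" if "\<bar>s\<bar> = 1" for s :: real
  proof (subst nn_integral_eq_integral)
    show "AE c in q. 0 \<le> 1 + s * real_of_int (\<xi> c)"
    proof (rule AE_I2)
      fix c
      have "\<bar>s * real_of_int (\<xi> c)\<bar> \<le> 1" using that bd'[of c] by (simp add: abs_mult)
      then show "0 \<le> 1 + s * real_of_int (\<xi> c)" by linarith
    qed
  qed (use int mean in simp_all)
  from this[of 1] this[of "-1"]
  have pm: "(\<integral>\<^sup>+c. ennreal (1 + real_of_int (\<xi> c)) \<partial>q) = 1" "(\<integral>\<^sup>+c. ennreal (1 - real_of_int (\<xi> c)) \<partial>q) = 1" by simp_all
  consider "\<delta> = 0" | "1 \<le> \<delta>" | "\<delta> \<le> -1" by linarith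
  then show ?thesis
  proof cases
    case 1
    have "(\<integral>\<^sup>+c. ennreal (1 + \<bar>real_of_int (\<xi> c)\<bar>) \<partial>q) = ennreal (1 + measure_pmf.expectation q (\<lambda>c. \<bar>real_of_int (\<xi> c)\<bar>))"
      using int by (subst nn_integral_eq_integral) auto
    with 1 nn show ?thesis by (simp add: ennreal_plus)
  next
    case 2
    have "\<bar>real_of_int (\<delta> + \<xi> c)\<bar> - \<bar>real_of_int \<delta>\<bar> = real_of_int (\<xi> c)" for c
      using 2 bd[of c] by linarith
    with 2 pm show ?thesis by simp
  next
    case 3
    have "\<bar>real_of_int (\<delta> + \<xi> c)\<bar> - \<bar>real_of_int \<delta>\<bar> = - real_of_int (\<xi> c)" for c
      using 3 bd[of c] by linarith
    with 3 pm show ?thesis by simp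
  qed
qed

context ow_graph
begin

section \<open>The law of a single firing\<close>

lemma prob_side_step: "x \<in> nbrs E y \<Longrightarrow> emeasure (step_pmf y) {c. side b c = x} = 1 / ennreal (real deg)"
proof -
  assume x: "x \<in> nbrs E y"
  have "emeasure (step_pmf y) {c. side b c = x} = emeasure (map_pmf (side b) (step_pmf y)) {x}"
    by (simp add: vimage_def)
  also have "map_pmf (side b) (step_pmf y) = pmf_of_set (nbrs E y)"
    unfolding step_pmf_def side_def by (cases b) (simp_all add: map_fst_pair_pmf map_snd_pair_pmf)
  also have "emeasure (pmf_of_set (nbrs E y)) {x} = ennreal (1 / real deg)"
    using x finite_nbrs nbrs_nonempty by (subst emeasure_pmf_single) (auto simp: card_nbrs)
  also have "\<dots> = 1 / ennreal (real deg)"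
    using deg_ge_2 by (simp add: divide_ennreal[symmetric])
  finally show ?thesis .
qed

definition kick_of :: "'v \<Rightarrow> 'v \<times> 'v \<Rightarrow> int" where
  "kick_of x c = of_bool (fst c = x) - of_bool (snd c = x)"

text \<open>The \<open>p\<close> of the overview: a kick is -1, 0 or 1, so its mean absolute value
  is the probability that it is nonzero.\<close>

definition kick_prob :: "'v \<Rightarrow> 'v \<Rightarrow> real" where
  "kick_prob y x = measure_pmf.expectation (step_pmf y) (\<lambda>c. \<bar>real_of_int (kick_of x c)\<bar>)"

lemma expectation_kick: "measure_pmf.expectation (step_pmf y) (\<lambda>c. real_of_int (kick_of x c)) = 0"
proof -
  have b: "integrable (step_pmf y) (\<lambda>c. of_bool (Q c) :: real)" for Q
    by (rule measure_pmf.integrable_const_bound[where B=1]) auto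
  have "measure_pmf.expectation (step_pmf y) (\<lambda>c. real_of_int (kick_of x c))
      = measure_pmf.expectation (step_pmf y) (\<lambda>c. of_bool (fst c = x)) - measure_pmf.expectation (step_pmf y) (\<lambda>c. of_bool (snd c = x))"
    unfolding kick_of_def by (subst Bochner_Integration.integral_diff[symmetric]) (simp_all add: b)
  also have "measure_pmf.expectation (step_pmf y) (\<lambda>c. of_bool (fst c = x) :: real) = measure_pmf.expectation (map_pmf fst (step_pmf y)) (\<lambda>z. of_bool (z = x))"
    by (simp only: integral_map_pmf)
  also have "measure_pmf.expectation (step_pmf y) (\<lambda>c. of_bool (snd c = x) :: real) = measure_pmf.expectation (map_pmf snd (step_pmf y)) (\<lambda>z. of_bool (z = x))"
    by (simp only: integral_map_pmf)
  finally show ?thesis unfolding step_pmf_def map_fst_pair_pmf map_snd_pair_pmf by simp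
qed

text \<open>The oil may jump to \<open>x\<close> while the water jumps to another neighbour
  \<open>z\<close> of \<open>y\<close>, which exists because the degree is at least 2.\<close>

lemma kick_prob_pos:
  assumes "y \<in> nbrs E x"
  shows "0 < kick_prob y x"
proof -
  have x: "x \<in> nbrs E y" using assms sym by (simp add: nbrs_def)
  have "\<not> nbrs E y \<subseteq> {x}"
    using card_nbrs[of y] deg_ge_2 card_mono[of "{x}" "nbrs E y"] by auto
  then obtain z where z: "z \<in> nbrs E y" "z \<noteq> x" by auto
  have "0 < pmf (step_pmf y) (x, z)"
    using x z by (intro pmf_positive) (simp add: set_step_pmf)
  also have "pmf (step_pmf y) (x, z) = measure_pmf.expectation (step_pmf y) (indicator {(x, z)})"
    by (simp add: measure_pmf_single)
  also have "\<dots> \<le> kick_prob y x"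
    unfolding kick_prob_def
    by (intro integral_mono measure_pmf.integrable_const_bound[where B=1])
      (use z in \<open>auto simp: kick_of_def indicator_def split: if_splits\<close>)
  finally show ?thesis .
qed

section \<open>Expected firings and conservation of the mean\<close>

definition fire_prob :: "'v \<Rightarrow> nat \<Rightarrow> real \<Rightarrow> ennreal" where
  "fire_prob y k t = emeasure P {w. ring w y k < t \<and> fires E w y k}"

definition expected_firings :: "'v \<Rightarrow> real \<Rightarrow> ennreal" where
  "expected_firings y t = (\<Sum>k. fire_prob y k t)"

lemma firing_events [measurable]: "{w. ring w y k < t \<and> fires E w y k} \<in> events"
proof -
  have "{w \<in> space P. ring w y k < t \<and> fires E w y k} \<in> events" by measurable
  then show ?thesis by simp
qed

text \<open>Every firing is a ring, and rings have Lebesgue intensity. Finiteness is what permits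
  the later cancellations in \<open>ennreal\<close>.\<close>

lemma expected_firings_finite: "expected_firings y t < \<infinity>"
proof -
  have "fire_prob y k t \<le> emeasure clock_measure {S. ring_time S y k \<in> {..<t}}" for k
  proof -
    have "{w \<in> space P. ring w y k < t} \<in> events" by measurable
    then have "fire_prob y k t \<le> emeasure P {w \<in> space P. ring w y k < t}"
      unfolding fire_prob_def by (intro emeasure_mono) auto
    also have "\<dots> = emeasure (distr P clock_measure (\<lambda>w. fst (snd w))) {S. ring_time S y k \<in> {..<t}}"
      using ring_time_events[of "{..<t}" y k]
      by (subst emeasure_distr) (auto intro!: arg_cong2[where f=emeasure] simp: ring_eq_ring_time)
    finally show ?thesis by (simp add: distr_clock)
  qed
  then have "expected_firings y t \<le> (\<Sum>k. emeasure clock_measure {S. ring_time S y k \<in> {..<t}})"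
    unfolding expected_firings_def by (intro suminf_le) auto
  also have "\<dots> = emeasure lborel ({..<t} \<inter> {0..})" by (rule expected_rings) simp
  also have "\<dots> \<le> emeasure lborel {0..max 0 t}" by (intro emeasure_mono) auto
  also have "\<dots> < \<infinity>" by simp
  finally show ?thesis .
qed

text \<open>Here transitivity enters beyond the constant degree: an automorphism taking
  \<open>x\<close> to \<open>y\<close> preserves the law of the sample and carries firings at
  \<open>x\<close> to firings at \<open>y\<close>.\<close>

lemma expected_firings_eq: "expected_firings y t = expected_firings x t"
proof -
  obtain f where f: "bij f" "\<And>a b. E a b \<longleftrightarrow> E (f a) (f b)" "f x = y"
    using transitive unfolding vertex_transitive_def by blast
  note inv = relabel_invariant[of f, OF f(1,2)]
  have "fire_prob y k t = fire_prob x k t" for k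
  proof -
    have "fire_prob y k t = emeasure (distr P P (relabel f)) {w. ring w y k < t \<and> fires E w y k}"
      unfolding fire_prob_def inv(2) ..
    also have "\<dots> = emeasure P (relabel f -` {w. ring w y k < t \<and> fires E w y k} \<inter> space P)"
      by (intro emeasure_distr inv(1) firing_events)
    also have "relabel f -` {w. ring w y k < t \<and> fires E w y k} \<inter> space P = {w. ring w x k < t \<and> fires E w x k}"
      unfolding f(3)[symmetric] by (auto simp: ring_relabel[OF f(1)] fires_relabel[of f E, OF f(1,2)])
    finally show ?thesis unfolding fire_prob_def .
  qed
  then show ?thesis by (simp add: expected_firings_def)
qed

lemma nn_integral_departures: "(\<integral>\<^sup>+w. of_nat (departures w (fires E w) y t) \<partial>P) = expected_firings y t"
proof -
  have "(\<integral>\<^sup>+w. of_nat (departures w (fires E w) y t) \<partial>P)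
      = (\<integral>\<^sup>+w. (\<Sum>k. indicator {w. ring w y k < t \<and> fires E w y k} w) \<partial>P)"
  proof (rule nn_integral_cong_AE, use AE_good_sample in eventually_elim)
    fix w assume "good_sample E w"
    then interpret good_sample E w .
    show "of_nat (departures w (fires E w) y t) = (\<Sum>k. indicator {w. ring w y k < t \<and> fires E w y k} w :: ennreal)"
      using suminf_indicator[OF fin_rings'[of y t "fires E w y"]] by (simp add: departures_def indicator_def)
  qed
  also have "\<dots> = (\<Sum>k. \<integral>\<^sup>+w. indicator {w. ring w y k < t \<and> fires E w y k} w \<partial>P)"
    by (rule nn_integral_suminf) (intro borel_measurable_indicator firing_events)
  finally show ?thesis unfolding expected_firings_def fire_prob_def by (simp add: nn_integral_indicator)
qed

text \<open>Whether a ring of \<open>y\<close> fires does not depend on its own choice, so the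
  destination can be averaged out first, at the cost of a factor \<open>1 / deg\<close>.\<close>

lemma nn_integral_arrivals:
  assumes "y \<in> nbrs E x"
  shows "(\<integral>\<^sup>+w. of_nat (arrivals b w (fires E w) y x t) \<partial>P) = expected_firings y t / ennreal (real deg)"
proof -
  have x: "x \<in> nbrs E y" using assms sym by (simp add: nbrs_def)
  let ?f = "\<lambda>k w. indicator {w. ring w y k < t \<and> fires E w y k} w * indicator {c. side b c = x} (choice w y k) :: ennreal"
  have m [measurable]: "?f k \<in> borel_measurable P" for k
    by (intro borel_measurable_times_ennreal borel_measurable_indicator firing_events measurable_compose[OF measurable_choice])
      (simp_all add: borel_measurable_indicator)
  have "(\<integral>\<^sup>+w. of_nat (arrivals b w (fires E w) y x t) \<partial>P) = (\<integral>\<^sup>+w. (\<Sum>k. ?f k w) \<partial>P)"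
  proof (rule nn_integral_cong_AE, use AE_good_sample in eventually_elim)
    fix w assume "good_sample E w"
    then interpret good_sample E w .
    have "?f k w = indicator {k. ring w y k < t \<and> fires E w y k \<and> side b (choice w y k) = x} k" for k
      by (simp add: indicator_def)
    then show "of_nat (arrivals b w (fires E w) y x t) = (\<Sum>k. ?f k w)"
      using suminf_indicator[OF fin_rings'[of y t "\<lambda>k. fires E w y k \<and> side b (choice w y k) = x"]]
      by (simp add: arrivals_def)
  qed
  also have "\<dots> = (\<Sum>k. \<integral>\<^sup>+w. ?f k w \<partial>P)" by (rule nn_integral_suminf) (rule m)
  also have "\<dots> = (\<Sum>k. fire_prob y k t * (1 / ennreal (real deg)))"
  proof (intro suminf_cong)
    fix k
    have "(\<integral>\<^sup>+w. ?f k w \<partial>P) = (\<integral>\<^sup>+w. (\<integral>\<^sup>+c. ?f k (set_choice w (y, k) c) \<partial>measure_pmf (step_pmf (fst (y, k)))) \<partial>P)"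
      by (rule nn_integral_set_choice[OF m])
    also have "\<dots> = (\<integral>\<^sup>+w. indicator {w. ring w y k < t \<and> fires E w y k} w * (1 / ennreal (real deg)) \<partial>P)"
    proof (rule nn_integral_cong)
      fix w
      have "?f k (set_choice w (y, k) c) = indicator {w. ring w y k < t \<and> fires E w y k} w * indicator {c. side b c = x} c" for c
        by (simp add: choice_set_choice indicator_def)
      then show "(\<integral>\<^sup>+c. ?f k (set_choice w (y, k) c) \<partial>measure_pmf (step_pmf (fst (y, k))))
          = indicator {w. ring w y k < t \<and> fires E w y k} w * (1 / ennreal (real deg))"
        using prob_side_step[OF x, of b] by (simp add: nn_integral_cmult)
    qed
    also have "\<dots> = fire_prob y k t * (1 / ennreal (real deg))"
      unfolding fire_prob_def
      by (subst nn_integral_multc) (auto intro: borel_measurable_indicator firing_events simp: nn_integral_indicator)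
    finally show "(\<integral>\<^sup>+w. ?f k w \<partial>P) = fire_prob y k t * (1 / ennreal (real deg))" .
  qed
  also have "\<dots> = expected_firings y t / ennreal (real deg)"
    unfolding expected_firings_def by (simp add: ennreal_suminf_multc ennreal_times_divide)
  finally show ?thesis .
qed

definition init_mean :: ennreal where
  "init_mean = (\<integral>\<^sup>+n. of_nat n \<partial>measure_pmf \<nu>)"

lemma nn_integral_init: "(\<integral>\<^sup>+w. of_nat (side b (fst w x)) \<partial>P) = init_mean"
proof -
  have "(\<integral>\<^sup>+w. of_nat (side b (fst w x)) \<partial>P) = (\<integral>\<^sup>+X. of_nat (side b (X x)) \<partial>init_measure \<nu>)"
  proof -
    have "(\<lambda>X. X x) \<in> measurable (init_measure \<nu>) (measure_pmf (pair_pmf \<nu> \<nu>))"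
      unfolding init_measure_def by (rule measurable_component_singleton) simp
    then have m: "(\<lambda>X. of_nat (side b (X x)) :: ennreal) \<in> borel_measurable (init_measure \<nu>)"
      by (rule measurable_compose) simp
    have "(\<integral>\<^sup>+X. of_nat (side b (X x)) \<partial>distr P (init_measure \<nu>) fst) = (\<integral>\<^sup>+w. of_nat (side b (fst w x)) \<partial>P)"
      by (rule nn_integral_distr[OF measurable_fst_P]) (simp add: m)
    then show ?thesis by (simp only: distr_init)
  qed
  also have "\<dots> = (\<integral>\<^sup>+p. of_nat (side b p) \<partial>pair_pmf \<nu> \<nu>)"
    unfolding init_measure_def
    by (subst (2) distr_PiM_component[of UNIV "\<lambda>_. measure_pmf (pair_pmf \<nu> \<nu>)" x, symmetric])
      (auto simp: prob_space_measure_pmf nn_integral_distr)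
  also have "\<dots> = (\<integral>\<^sup>+n. of_nat n \<partial>map_pmf (side b) (pair_pmf \<nu> \<nu>))" by simp
  also have "map_pmf (side b) (pair_pmf \<nu> \<nu>) = \<nu>"
    unfolding side_def by (cases b) (simp_all add: map_fst_pair_pmf map_snd_pair_pmf)
  finally show ?thesis unfolding init_mean_def .
qed

lemma measurable_of_nat_P:
  "(\<lambda>w. of_nat (departures w (fires E w) y t) :: ennreal) \<in> borel_measurable P"
  "(\<lambda>w. of_nat (arrivals b w (fires E w) y x t) :: ennreal) \<in> borel_measurable P"
  "(\<lambda>w. of_nat (side b (fst w x)) :: ennreal) \<in> borel_measurable P"
proof -
  have c: "(\<lambda>w. of_nat (card (S w)) :: ennreal) \<in> borel_measurable P"
    if "\<And>k :: nat. Measurable.pred P (\<lambda>w. k \<in> S w)" for S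
  proof -
    have "(\<lambda>w. card (S w)) \<in> measurable P (count_space UNIV)"
      using that by (intro measurable_card) (simp only: pred_def)
    then show ?thesis by (rule measurable_compose) simp
  qed
  show "(\<lambda>w. of_nat (departures w (fires E w) y t) :: ennreal) \<in> borel_measurable P"
    unfolding departures_def by (rule c) simp
  have [measurable]: "Measurable.pred P (\<lambda>w. side b (choice w y k) = x)" for k
    using measurable_choice by (rule measurable_compose) simp
  show "(\<lambda>w. of_nat (arrivals b w (fires E w) y x t) :: ennreal) \<in> borel_measurable P"
    unfolding arrivals_def by (rule c) simp
  show "(\<lambda>w. of_nat (side b (fst w x)) :: ennreal) \<in> borel_measurable P"
    using measurable_init by (rule measurable_compose) simp
qed

text \<open>Inflow balances outflow: \<open>deg\<close> neighbours each contribute a fraction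
  \<open>1 / deg\<close> of the common expected number of firings. The departures are added to the
  stock and cancelled at the end.\<close>

lemma nn_integral_stock:
  "(\<integral>\<^sup>+w. ennreal (real_of_int (stock E b w (fires E w) x t)) \<partial>P) = init_mean"
proof -
  let ?D = "\<lambda>w. of_nat (departures w (fires E w) x t) :: ennreal"
  let ?S = "\<lambda>w. ennreal (real_of_int (stock E b w (fires E w) x t))"
  note [measurable] = measurable_of_nat_P measurable_stock[where F="fires E", OF measurable_fires]
  have "(\<integral>\<^sup>+w. ?S w \<partial>P) + expected_firings x t = (\<integral>\<^sup>+w. ?S w + ?D w \<partial>P)"
    by (subst nn_integral_add) (simp_all add: nn_integral_departures)
  also have "\<dots> = (\<integral>\<^sup>+w. of_nat (side b (fst w x)) + (\<Sum>y\<in>nbrs E x. of_nat (arrivals b w (fires E w) y x t)) \<partial>P)"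
  proof (rule nn_integral_cong_AE, use AE_good_sample in eventually_elim)
    fix w assume "good_sample E w"
    then interpret good_sample E w .
    have "?S w + ?D w = ennreal (real_of_int (stock E b w (fires E w) x t) + real (departures w (fires E w) x t))"
      using stock_nonneg by (simp add: ennreal_plus ennreal_of_nat_eq_real_of_nat)
    also have "\<dots> = ennreal (real (side b (fst w x) + (\<Sum>y\<in>nbrs E x. arrivals b w (fires E w) y x t)))"
      unfolding stock_def by simp
    finally show "?S w + ?D w = of_nat (side b (fst w x)) + (\<Sum>y\<in>nbrs E x. of_nat (arrivals b w (fires E w) y x t))"
      unfolding ennreal_of_nat_eq_real_of_nat[symmetric] by simp
  qed
  also have "\<dots> = init_mean + (\<Sum>y\<in>nbrs E x. expected_firings y t / ennreal (real deg))"
    by (subst nn_integral_add) (simp_all add: nn_integral_init nn_integral_sum nn_integral_arrivals)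
  also have "(\<Sum>y\<in>nbrs E x. expected_firings y t / ennreal (real deg)) = (\<Sum>y\<in>nbrs E x. expected_firings x t / ennreal (real deg))"
    by (intro sum.cong arg_cong2[where f="(/)"] expected_firings_eq refl)
  also have "\<dots> = expected_firings x t"
    using deg_ge_2 by (simp add: card_nbrs ennreal_times_divide ennreal_of_nat_eq_real_of_nat mult.commute[of "ennreal (real deg)"] ennreal_mult_divide_eq)
  finally show ?thesis
    using expected_firings_finite[of x t] by (auto simp: ennreal_add_left_cancel add.commute[of _ "expected_firings x t"])
qed

text \<open>Both stocks are nonnegative, so their difference is bounded by their sum. The bound
  \<open>2 * init_mean\<close> is the \<mu> of the theorem and does not depend on
  \<open>t\<close>.\<close>

lemma nn_integral_gap: "(\<integral>\<^sup>+w. ennreal \<bar>real_of_int (gap E w x t)\<bar> \<partial>P) \<le> 2 * init_mean"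
proof -
  let ?S = "\<lambda>b w. ennreal (real_of_int (stock E b w (fires E w) x t))"
  note [measurable] = measurable_stock[where F="fires E", OF measurable_fires]
  have "(\<integral>\<^sup>+w. ennreal \<bar>real_of_int (gap E w x t)\<bar> \<partial>P) \<le> (\<integral>\<^sup>+w. ?S True w + ?S False w \<partial>P)"
  proof (rule nn_integral_mono_AE, use AE_good_sample in eventually_elim)
    fix w assume "good_sample E w"
    then interpret good_sample E w .
    show "ennreal \<bar>real_of_int (gap E w x t)\<bar> \<le> ?S True w + ?S False w"
    proof -
      have "?S True w + ?S False w = ennreal (real_of_int (stock E True w (fires E w) x t) + real_of_int (stock E False w (fires E w) x t))"
        using stock_nonneg by (simp add: ennreal_plus)
      also have "\<dots> \<ge> ennreal \<bar>real_of_int (gap E w x t)\<bar>"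
        using stock_nonneg[of True x t] stock_nonneg[of False x t] unfolding gap_def by (intro ennreal_leI) linarith
      finally show ?thesis .
    qed
  qed
  also have "\<dots> = 2 * init_mean"
    by (subst nn_integral_add) (simp_all add: nn_integral_stock mult_2)
  finally show ?thesis .
qed

section \<open>Firings that see a given gap\<close>

definition visit_prob :: "'v \<Rightarrow> int \<Rightarrow> 'v \<Rightarrow> nat \<Rightarrow> real \<Rightarrow> ennreal" where
  "visit_prob x a y k t = emeasure P {w. ring w y k < t \<and> fires E w y k \<and> gap E w x (ring w y k) = a}"

lemma visit_events [measurable]: "{w. ring w y k < t \<and> fires E w y k \<and> gap E w x (ring w y k) = a} \<in> events"
proof -
  note [measurable] = measurable_gap[OF measurable_ring]
  have "{w \<in> space P. ring w y k < t \<and> fires E w y k \<and> real_of_int (gap E w x (ring w y k)) = real_of_int a} \<in> events"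
    by measurable
  then show ?thesis by simp
qed

text \<open>The number of firings is added to both sides of the telescoped identity so that every summand is
  nonnegative; its expectation is finite and cancels in the end.\<close>

lemma visits_bound:
  assumes y: "y \<in> nbrs E x"
  shows "ennreal (kick_prob y x) * (\<Sum>k. visit_prob x a y k t) \<le> 2 * init_mean + ennreal \<bar>real_of_int a\<bar>"
proof -
  note [measurable] = measurable_gap[OF measurable_ring] measurable_gap[OF measurable_const] measurable_of_nat_P
  let ?I = "\<lambda>z k w. indicator {w. ring w z k < t \<and> fires E w z k} w :: ennreal"
  let ?d = "\<lambda>z k w. gap E w x (ring w z k) - a"
  let ?h = "\<lambda>z k w. ennreal (1 + (\<bar>real_of_int (?d z k w + kick_of x (choice w z k))\<bar> - \<bar>real_of_int (?d z k w)\<bar>))"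
  let ?L = "\<lambda>w. ennreal \<bar>real_of_int (gap E w x t - a)\<bar>"
  have kick: "\<bar>kick_of x c\<bar> \<le> 1" for c by (simp add: kick_of_def)
  have hm [measurable]: "(\<lambda>w. ?I z k w * ?h z k w) \<in> borel_measurable P" for z k
  proof -
    have [measurable]: "(\<lambda>w. real_of_int (kick_of x (choice w z k))) \<in> borel_measurable P"
      using measurable_choice by (rule measurable_compose) simp
    show ?thesis unfolding of_int_add of_int_diff by measurable
  qed
  have Lm [measurable]: "?L \<in> borel_measurable P" unfolding of_int_diff by measurable
  \<comment> \<open>The indicator and \<open>?d\<close> are determined before the choice at ring
    \<open>k\<close> of \<open>z\<close>, so resampling that choice averages over the kick
    only.\<close>
  have step: "(\<integral>\<^sup>+w. ?I z k w * ?h z k w \<partial>P) = fire_prob z k t + ennreal (kick_prob z x) * visit_prob x a z k t" for z k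
  proof -
    have "(\<integral>\<^sup>+w. ?I z k w * ?h z k w \<partial>P)
        = (\<integral>\<^sup>+w. (\<integral>\<^sup>+c. ?I z k (set_choice w (z, k) c) * ?h z k (set_choice w (z, k) c) \<partial>measure_pmf (step_pmf (fst (z, k)))) \<partial>P)"
      by (rule nn_integral_set_choice[OF hm])
    also have "\<dots> = (\<integral>\<^sup>+w. ?I z k w + ennreal (kick_prob z x) *
        indicator {w. ring w z k < t \<and> fires E w z k \<and> gap E w x (ring w z k) = a} w \<partial>P)"
    proof (rule nn_integral_cong)
      fix w
      have "(\<integral>\<^sup>+c. ?I z k (set_choice w (z, k) c) * ?h z k (set_choice w (z, k) c) \<partial>measure_pmf (step_pmf (fst (z, k))))
          = ?I z k w * (\<integral>\<^sup>+c. ennreal (1 + (\<bar>real_of_int (?d z k w + kick_of x c)\<bar> - \<bar>real_of_int (?d z k w)\<bar>)) \<partial>step_pmf z)"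
        by (subst nn_integral_cmult[symmetric]) (simp_all add: choice_set_choice indicator_def)
      also have "\<dots> = ?I z k w * (1 + ennreal (kick_prob z x) * of_bool (?d z k w = 0))"
        unfolding kick_prob_def by (subst nn_integral_abs_step[OF kick expectation_kick]) simp
      finally show "(\<integral>\<^sup>+c. ?I z k (set_choice w (z, k) c) * ?h z k (set_choice w (z, k) c) \<partial>measure_pmf (step_pmf (fst (z, k))))
          = ?I z k w + ennreal (kick_prob z x) * indicator {w. ring w z k < t \<and> fires E w z k \<and> gap E w x (ring w z k) = a} w"
        by (auto simp: indicator_def)
    qed
    also have "\<dots> = fire_prob z k t + ennreal (kick_prob z x) * visit_prob x a z k t"
      unfolding fire_prob_def visit_prob_def
      by (subst nn_integral_add) (simp_all add: firing_events visit_events nn_integral_cmult)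
    finally show ?thesis .
  qed
  have "(\<integral>\<^sup>+w. ?L w \<partial>P) + (\<Sum>z\<in>nbrs E x. expected_firings z t)
      = (\<integral>\<^sup>+w. ?L w + (\<Sum>z\<in>nbrs E x. of_nat (departures w (fires E w) z t)) \<partial>P)"
    by (subst nn_integral_add) (simp_all add: nn_integral_sum nn_integral_departures)
  also have "\<dots> \<ge> (\<integral>\<^sup>+w. (\<Sum>z\<in>nbrs E x. \<Sum>k. ?I z k w * ?h z k w) \<partial>P)"
  proof (rule nn_integral_mono_AE, use AE_good_sample in eventually_elim)
    fix w assume "good_sample E w"
    then interpret good_sample E w .
    let ?e = "\<lambda>i. 1 + (\<bar>real_of_int (?d (fst i) (snd i) w + kick_of x (choice w (fst i) (snd i)))\<bar> - \<bar>real_of_int (?d (fst i) (snd i) w)\<bar>)"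
    have e: "0 \<le> ?e i" for i using kick[of "choice w (fst i) (snd i)"] by linarith
    have F: "finite {k. ring w z k < t \<and> fires E w z k}" for z by (rule fin_rings')
    have "(\<Sum>k. ?I z k w * ?h z k w) = (\<Sum>k | ring w z k < t \<and> fires E w z k. ennreal (?e (z, k)))" for z
      using suminf_indicator_mult[OF F[of z], of "\<lambda>k. ?h z k w"] by (simp add: indicator_def)
    then have "(\<Sum>z\<in>nbrs E x. \<Sum>k. ?I z k w * ?h z k w) = (\<Sum>i\<in>nbr_firings x t. ennreal (?e i))"
      unfolding nbr_firings_def using fin_nbrs F by (simp add: sum.Sigma case_prod_unfold)
    also have "\<dots> = ennreal (\<Sum>i\<in>nbr_firings x t. ?e i)" using e by (intro sum_ennreal) auto
    also have "\<dots> \<le> ennreal (\<bar>real_of_int (gap E w x t - a)\<bar> + real (card (nbr_firings x t)))"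
    proof (rule ennreal_leI)
      have "(\<Sum>i\<in>nbr_firings x t. ?e i) = real (card (nbr_firings x t)) + (\<Sum>i\<in>nbr_firings x t. ?e i - 1)"
        by (simp add: sum_subtractf sum.distrib)
      \<comment> \<open>The nonnegative initial distance to \<open>a\<close> is dropped from the
        telescoped identity, leaving an inequality.\<close>
      moreover have "(\<Sum>i\<in>nbr_firings x t. ?e i - 1) \<le> \<bar>real_of_int (gap E w x t - a)\<bar>"
        using abs_gap_telescope[of x t a]
        by (simp add: kick_def kick_of_def algebra_simps cong: sum.cong)
      ultimately show "(\<Sum>i\<in>nbr_firings x t. ?e i) \<le> \<bar>real_of_int (gap E w x t - a)\<bar> + real (card (nbr_firings x t))"
        by linarith
    qed
    also have "\<dots> = ?L w + (\<Sum>z\<in>nbrs E x. of_nat (departures w (fires E w) z t))"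
      unfolding nbr_firings_def departures_def using fin_nbrs F
      by (simp add: card_SigmaI ennreal_plus ennreal_of_nat_eq_real_of_nat[symmetric] del: of_nat_sum) simp
    finally show "(\<Sum>z\<in>nbrs E x. \<Sum>k. ?I z k w * ?h z k w) \<le> ?L w + (\<Sum>z\<in>nbrs E x. of_nat (departures w (fires E w) z t))" .
  qed
  also have "(\<integral>\<^sup>+w. (\<Sum>z\<in>nbrs E x. \<Sum>k. ?I z k w * ?h z k w) \<partial>P)
      = (\<Sum>z\<in>nbrs E x. \<Sum>k. fire_prob z k t + ennreal (kick_prob z x) * visit_prob x a z k t)"
  proof (subst nn_integral_sum)
    show "(\<lambda>w. \<Sum>k. ?I z k w * ?h z k w) \<in> borel_measurable P" for z
      by (intro borel_measurable_suminf_order hm)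
  qed (simp only: nn_integral_suminf[OF hm] step)
  also have "\<dots> = (\<Sum>z\<in>nbrs E x. expected_firings z t) + (\<Sum>z\<in>nbrs E x. ennreal (kick_prob z x) * (\<Sum>k. visit_prob x a z k t))"
    unfolding expected_firings_def by (simp add: suminf_add[symmetric] sum.distrib)
  finally have "(\<Sum>z\<in>nbrs E x. expected_firings z t) + (\<Sum>z\<in>nbrs E x. ennreal (kick_prob z x) * (\<Sum>k. visit_prob x a z k t))
      \<le> (\<Sum>z\<in>nbrs E x. expected_firings z t) + (\<integral>\<^sup>+w. ?L w \<partial>P)"
    by (simp add: add.commute)
  moreover have "(\<Sum>z\<in>nbrs E x. expected_firings z t) < \<infinity>"
    using expected_firings_finite finite_nbrs by simp
  ultimately have le: "(\<Sum>z\<in>nbrs E x. ennreal (kick_prob z x) * (\<Sum>k. visit_prob x a z k t)) \<le> (\<integral>\<^sup>+w. ?L w \<partial>P)"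
    by (auto simp: ennreal_add_left_cancel_le)
  have "ennreal (kick_prob y x) * (\<Sum>k. visit_prob x a y k t)
      \<le> (\<Sum>z\<in>nbrs E x. ennreal (kick_prob z x) * (\<Sum>k. visit_prob x a z k t))"
    using y finite_nbrs by (intro member_le_sum) auto
  also note le
  also have "(\<integral>\<^sup>+w. ?L w \<partial>P) \<le> (\<integral>\<^sup>+w. ennreal \<bar>real_of_int (gap E w x t)\<bar> + ennreal \<bar>real_of_int a\<bar> \<partial>P)"
  proof (rule nn_integral_mono)
    fix w
    have "?L w \<le> ennreal (\<bar>real_of_int (gap E w x t)\<bar> + \<bar>real_of_int a\<bar>)"
      by (rule ennreal_leI) linarith
    then show "?L w \<le> ennreal \<bar>real_of_int (gap E w x t)\<bar> + ennreal \<bar>real_of_int a\<bar>"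
      by (simp only: ennreal_plus abs_ge_zero)
  qed
  also have "\<dots> = (\<integral>\<^sup>+w. ennreal \<bar>real_of_int (gap E w x t)\<bar> \<partial>P) + ennreal \<bar>real_of_int a\<bar>"
    by (subst nn_integral_add) (simp_all add: emeasure_space_1[simplified])
  also have "\<dots> \<le> 2 * init_mean + ennreal \<bar>real_of_int a\<bar>"
    by (intro add_right_mono nn_integral_gap)
  finally show ?thesis .
qed

text \<open>The bound on visits is uniform in \<open>t\<close>, so it survives the limit over
  integer times; dividing by the positive \<open>kick_prob y x\<close> makes the series summable,
  and the Borel-Cantelli lemma applies.\<close>

lemma AE_finite_visits:
  assumes mean: "init_mean < \<infinity>" and y: "y \<in> nbrs E x"
  shows "AE w in P. finite {k. fires E w y k \<and> gap E w x (ring w y k) = a}"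
proof (rule AE_finite_of_suminf)
  let ?A = "\<lambda>k n. {w. ring w y k < real n \<and> fires E w y k \<and> gap E w x (ring w y k) = a}"
  have U: "(\<Union>n. ?A k n) = {w \<in> space P. fires E w y k \<and> gap E w x (ring w y k) = a}" for k
    using reals_Archimedean2 by auto
  show "{w \<in> space P. fires E w y k \<and> gap E w x (ring w y k) = a} \<in> events" for k
    unfolding U[symmetric] by (intro sets.countable_UN) (auto intro: visit_events)
  have inc: "incseq (?A k)" for k by (auto simp: incseq_def intro: order.strict_trans2)
  have "ennreal (kick_prob y x) * (\<Sum>k. emeasure P {w \<in> space P. fires E w y k \<and> gap E w x (ring w y k) = a})
      = ennreal (kick_prob y x) * (\<Sum>k. SUP n. visit_prob x a y k (real n))"
    unfolding visit_prob_def U[symmetric] using inc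
    by (subst SUP_emeasure_incseq) (auto intro: visit_events)
  also have "\<dots> = (SUP n. ennreal (kick_prob y x) * (\<Sum>k. visit_prob x a y k (real n)))"
  proof (subst ennreal_suminf_SUP_eq)
    show "incseq (\<lambda>n. visit_prob x a y k (real n))" for k
      unfolding visit_prob_def using inc[of k]
      by (auto simp: incseq_def intro!: emeasure_mono visit_events)
  qed (simp add: SUP_mult_left_ennreal)
  also have "\<dots> \<le> 2 * init_mean + ennreal \<bar>real_of_int a\<bar>"
    by (intro SUP_least visits_bound y)
  also have "\<dots> < \<infinity>" using mean by (simp add: ennreal_mult_less_top)
  finally show "(\<Sum>k. emeasure P {w \<in> space P. fires E w y k \<and> gap E w x (ring w y k) = a}) < \<infinity>"
    using kick_prob_pos[OF y] by (auto simp: ennreal_mult_less_top)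
qed

text \<open>By Fatou's lemma the lower limit of the absolute gap along integer times has finite
  mean, hence is almost surely finite. The bound \<open>K\<close> may depend on the sample.\<close>

lemma AE_gap_recurs:
  assumes mean: "init_mean < \<infinity>"
  shows "AE w in P. \<exists>K. \<exists>\<^sub>\<infinity>n. \<bar>gap E w x (real n)\<bar> \<le> K"
proof -
  let ?g = "\<lambda>n w. ennreal \<bar>real_of_int (gap E w x (real n))\<bar>"
  note [measurable] = measurable_gap[OF measurable_const]
  have "(\<integral>\<^sup>+w. liminf (\<lambda>n. ?g n w) \<partial>P) \<le> liminf (\<lambda>n. \<integral>\<^sup>+w. ?g n w \<partial>P)"
    by (rule nn_integral_liminf) measurable
  also have "\<dots> \<le> 2 * init_mean"
    by (intro Liminf_le) (auto simp: nn_integral_gap)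
  also have "\<dots> < \<infinity>" using mean by (simp add: ennreal_mult_less_top)
  finally have "AE w in P. liminf (\<lambda>n. ?g n w) \<noteq> \<infinity>"
    by (intro nn_integral_PInf_AE) auto
  then show ?thesis
  proof (rule eventually_mono)
    fix w assume fin: "liminf (\<lambda>n. ?g n w) \<noteq> \<infinity>"
    show "\<exists>K. \<exists>\<^sub>\<infinity>n. \<bar>gap E w x (real n)\<bar> \<le> K"
    proof (rule ccontr)
      assume no: "\<nexists>K. \<exists>\<^sub>\<infinity>n. \<bar>gap E w x (real n)\<bar> \<le> K"
      have "of_nat K \<le> liminf (\<lambda>n. ?g n w)" for K :: nat
      proof (rule Liminf_bounded)
        have "\<forall>\<^sub>\<infinity>n. \<not> \<bar>gap E w x (real n)\<bar> \<le> int K" using no by (simp add: not_INFM)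
        then show "\<forall>\<^sub>F n in sequentially. of_nat K \<le> ?g n w"
          unfolding cofinite_eq_sequentially
        proof eventually_elim
          fix n assume "\<not> \<bar>gap E w x (real n)\<bar> \<le> int K"
          then have "real K \<le> \<bar>real_of_int (gap E w x (real n))\<bar>" by linarith
          then show "of_nat K \<le> ?g n w" by (simp add: ennreal_of_nat_eq_real_of_nat ennreal_leI)
        qed
      qed
      then have "liminf (\<lambda>n. ?g n w) = \<infinity>"
        using SUP_least[of UNIV of_nat "liminf (\<lambda>n. ?g n w)"] by (simp add: ennreal_SUP_of_nat_eq_top top_unique)
      with fin show False ..
    qed
  qed
qed

theorem AE_fixates:
  assumes mean: "init_mean < \<infinity>"
  shows "AE w in P. (\<exists>F. OW_trajectory w F) \<and> (\<forall>F. OW_trajectory w F \<longrightarrow> fixates w F)"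
proof -
  have "AE w in P. \<forall>x\<in>UNIV. \<forall>a\<in>UNIV. \<forall>y\<in>UNIV. y \<in> nbrs E x \<longrightarrow> finite {k. fires E w y k \<and> gap E w x (ring w y k) = a}"
    by (intro AE_ball_countable[THEN iffD2] countable_UNIV ballI AE_impI AE_finite_visits mean) auto
  moreover have "AE w in P. \<forall>x\<in>UNIV. \<exists>K. \<exists>\<^sub>\<infinity>n. \<bar>gap E w x (real n)\<bar> \<le> K"
    by (intro AE_ball_countable[THEN iffD2] countable_UNIV ballI AE_gap_recurs mean)
  ultimately show ?thesis using AE_good_sample
  proof eventually_elim
    fix w
    assume fin: "\<forall>x\<in>UNIV. \<forall>a\<in>UNIV. \<forall>y\<in>UNIV. y \<in> nbrs E x \<longrightarrow> finite {k. fires E w y k \<and> gap E w x (ring w y k) = a}"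
      and rec: "\<forall>x\<in>UNIV. \<exists>K. \<exists>\<^sub>\<infinity>n. \<bar>gap E w x (real n)\<bar> \<le> K" and "good_sample E w"
    then interpret good_sample E w by simp
    have "finite {k. fires E w y k}" for y
    proof -
      \<comment> \<open>The firings of \<open>y\<close> are observed through the gap at one of its
        neighbours, since the gap at \<open>y\<close> itself does not register them.\<close>
      obtain x where "x \<in> nbrs E y" using nbrs_nonempty by blast
      then have y: "y \<in> nbrs E x" using sym by (simp add: nbrs_def)
      obtain K where "\<exists>\<^sub>\<infinity>n. \<bar>gap E w x (real n)\<bar> \<le> K" using rec by blast
      from finite_nbr_fires[OF _ this y] fin show ?thesis by blast
    qed
    then show "(\<exists>F. OW_trajectory w F) \<and> (\<forall>F. OW_trajectory w F \<longrightarrow> fixates w F)"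
      using fixates_fires by (simp add: OW_trajectory_iff_fires)
  qed
qed

end

theorem theorem1p1:
  fixes E :: "'v \<Rightarrow> 'v \<Rightarrow> bool" and \<nu> :: "nat pmf"
  assumes "simple_graph E"
    and "connected_graph E"
    and "infinite (UNIV :: 'v set)"
    and "finite_degree E"
    and "vertex_transitive E"
    and "integrable (measure_pmf \<nu>) real"
  shows "AE \<omega> in OW_prob E \<nu>.
           (\<exists>F. OW_trajectory \<omega> F) \<and> (\<forall>F. OW_trajectory \<omega> F \<longrightarrow> fixates \<omega> F)"
proof -
  interpret ow_graph E \<nu> using assms(1-5) by unfold_locales
  have "init_mean = (\<integral>\<^sup>+n. ennreal (norm (real n)) \<partial>measure_pmf \<nu>)"
    unfolding init_mean_def by (intro nn_integral_cong) (simp add: ennreal_of_nat_eq_real_of_nat)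
  also have "\<dots> < \<infinity>" using assms(6) by (simp add: integrable_iff_bounded)
  finally show ?thesis by (rule AE_fixates)
qed

end
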